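(* (i) For each integer $k\geqslant 2$, the upper bound $e_{k,m}\leqslant m^{-(k-o(1))m}$ is attained for infinitely many $m$: for every $\varepsilon>0$ there are infinitely many integers $m$ with $e_{k,m}\geqslant m^{-(k+\varepsilon)m}$. Moreover the series $\sum_{m=0}^\infty e_{k,m}z^m$ and the product $\prod_p\bigl(1+\frac{(p-1)(z-1)}{p^{k+1}}\bigr)$ both converge to entire functions of $z$, and $$\sum_{m=0}^{\infty}e_{k,m}z^{m}=\prod_{p} \Bigl(1+\frac{(p-1)(z-1)}{p^{k+1}} \Bigr)\qquad\text{for all } z\in\mathbb C.$$ (ii) Likewise, for every $\varepsilon>0$ each of the inequalities $e_{S,m}\geqslant m^{-(2+\varepsilon)m}$, $e_{E,m}\geqslant m^{-(2+\varepsilon)m}$, $e_{O,m}\geqslant m^{-(3+\varepsilon)m}$ holds for infinitely many integers $m$. Moreover, both sides of each of the following three identities converge to entire functions of $z$, and the identities hold for all $z\in\mathbb C$: $$\sum_{m=0}^{\infty}e_{S,m}z^{m}=\prod_{p} \Bigl(1+\frac{z-1}{p^{2}} \Bigr),\quad \sum_{m=0}^{\infty}e_{E,m}z^{m}=\prod_{p} \Bigl(1+\frac{z-1}{p(p+1)} \Bigr),\quad \sum_{m=0}^{\infty}e_{O,m}z^{m}=\prod_{p} \Bigl(1+\frac{z-1}{p^{2}(p+1)} \Bigr).$$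
   Context: For a positive integer $n$ and $k\geqslant1$, $\omega_k(n)$ is the number of primes $p$ with $p^k\,\|\,n$ (primes dividing $n$ with multiplicity exactly $k$). For integers $m\geqslant0$, $e_{k,m}$ is the natural density of the positive integers $n$ with $\omega_k(n)=m$, i.e. $e_{k,m}=\lim_{x\to\infty}\frac1x\#\{n\leqslant x:\omega_k(n)=m\}$. Put $\omega_S(n)=\sum_{j\geqslant2}\omega_j(n)$, $\omega_E(n)=\sum_{j\geqslant2,\ j\text{ even}}\omega_j(n)$, $\omega_O(n)=\sum_{j\geqslant3,\ j\text{ odd}}\omega_j(n)$, and let $e_{S,m}$, $e_{E,m}$, $e_{O,m}$ be the natural densities of the positive integers $n$ with $\omega_S(n)=m$, $\omega_E(n)=m$, $\omega_O(n)=m$ respectively. All these densities exist. $\prod_p$ denotes a product over all primes. *)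

theory Defs
  imports "HOL-Complex_Analysis.Complex_Analysis" "HOL-Computational_Algebra.Primes"
begin

text \<open>
  Only meaningful for \<open>k \<ge> 1\<close> and \<open>n \<ge> 1\<close>; then the set is finite and
  \<open>multiplicity p n = k\<close> says that \<open>p ^ k\<close> exactly divides \<open>n\<close>.
\<close>
definition omega :: "nat \<Rightarrow> nat \<Rightarrow> nat" where
  "omega k n = card {p. prime p \<and> multiplicity p n = k}"

text \<open>
  The formally infinite sum of \<open>omega j n\<close> over \<open>j \<in> J\<close> is taken over its support, which is
  finite for \<open>n \<ge> 1\<close> (lemma below), because \<open>sum\<close> over an infinite set would be \<open>0\<close>.
\<close>
definition omega_sum :: "nat set \<Rightarrow> nat \<Rightarrow> nat" where
  "omega_sum J n = (\<Sum>j | j \<in> J \<and> omega j n \<noteq> 0. omega j n)"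

lemma finite_omega_support:
  assumes "n > 0"
  shows "finite {j. j \<in> J \<and> omega j n \<noteq> 0}"
proof (rule finite_subset)
  show "{j. j \<in> J \<and> omega j n \<noteq> 0} \<subseteq> insert 0 ((\<lambda>p. multiplicity p n) ` {p. p dvd n})"
  proof
    fix j assume "j \<in> {j. j \<in> J \<and> omega j n \<noteq> 0}"
    then have "{p. prime p \<and> multiplicity p n = j} \<noteq> {}"
      unfolding omega_def by (metis (mono_tags, lifting) card.empty mem_Collect_eq)
    then obtain p where "multiplicity p n = j" by blast
    then show "j \<in> insert 0 ((\<lambda>p. multiplicity p n) ` {p. p dvd n})"
      using not_dvd_imp_multiplicity_0[of p n] by auto
  qed
  show "finite (insert 0 ((\<lambda>p. multiplicity p n) ` {p. p dvd n}))"
    using assms by (simp add: finite_divisors_nat)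
qed

definition omega_S :: "nat \<Rightarrow> nat" where
  "omega_S = omega_sum {j. j \<ge> 2}"

definition omega_E :: "nat \<Rightarrow> nat" where
  "omega_E = omega_sum {j. j \<ge> 2 \<and> even j}"

definition omega_O :: "nat \<Rightarrow> nat" where
  "omega_O = omega_sum {j. j \<ge> 3 \<and> odd j}"

definition has_natural_density :: "nat set \<Rightarrow> real \<Rightarrow> bool" where
  "has_natural_density A d \<longleftrightarrow>
     ((\<lambda>x::real. real (card {n \<in> A. 1 \<le> n \<and> real n \<le> x}) / x) \<longlongrightarrow> d) at_top"

definition natural_density :: "nat set \<Rightarrow> real" where
  "natural_density A = (THE d. has_natural_density A d)"

definition e :: "nat \<Rightarrow> nat \<Rightarrow> real" where
  "e k m = natural_density {n. n \<ge> 1 \<and> omega k n = m}"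

definition e_S :: "nat \<Rightarrow> real" where
  "e_S m = natural_density {n. n \<ge> 1 \<and> omega_S n = m}"

definition e_E :: "nat \<Rightarrow> real" where
  "e_E m = natural_density {n. n \<ge> 1 \<and> omega_E n = m}"

definition e_O :: "nat \<Rightarrow> real" where
  "e_O m = natural_density {n. n \<ge> 1 \<and> omega_O n = m}"

text \<open>
  Convergence of a product over all primes, taken in increasing order: the factors at
  non-primes are \<open>1\<close>. As usual for \<open>has_prod\<close>, finitely many factors may vanish.
\<close>
definition has_prime_prod :: "(nat \<Rightarrow> complex) \<Rightarrow> complex \<Rightarrow> bool" where
  "has_prime_prod f P \<longleftrightarrow> (\<lambda>n. if prime n then f n else 1) has_prod P"

end

theory Submission
  imports Defs "HOL-Real_Asymp.Real_Asymp"
begin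

text \<open>
  Fix a set \<open>J\<close> of exponents with least element \<open>\<kappa>\<close>, and let \<open>c p\<close> be the density of the \<open>n\<close> whose
  \<open>p\<close>-adic valuation lies in \<open>J\<close>; it lies between \<open>p\<^sup>-\<^sup>\<kappa> / 2\<close> and \<open>p\<^sup>-\<^sup>\<kappa>\<close>. All four statistics count the
  primes \<open>p\<close> whose valuation lies in such a \<open>J\<close>, so all claims are instances of one theory, developed
  in the locale \<open>exponent_set\<close> under the hypothesis \<open>\<Sum> p\<^sup>-\<^sup>\<kappa> < \<infinity>\<close>.

  Valuations at different primes are independent with respect to density
  (\<open>density_multiplicity_in\<close>), so the number of \<open>p < Y\<close> with valuation in \<open>J\<close> has the law of a sum of
  independent Bernoulli variables with parameters \<open>c p\<close>, whose generating function is
  \<open>\<Prod>p<Y. 1 + c p * (z - 1)\<close>. Letting \<open>Y\<close> tend to infinity costs a set of density at most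
  \<open>\<Sum>p\<ge>Y. p\<^sup>-\<^sup>\<kappa>\<close> (\<open>count_differ\<close>), so the densities \<open>E m\<close> exist. The coefficients of the finite products
  are at most \<open>exp (R * \<Sum> c p) / R ^ m\<close> for each \<open>R \<ge> 1\<close>, uniformly in \<open>Y\<close>, and dominated convergence
  yields the identity of entire functions for every complex \<open>z\<close>.

  The bounds on \<open>E m\<close> compare the decay of the coefficients with the growth of
  \<open>G R = (\<Sum>m. E m * R ^ m) = (\<Prod>p. 1 + c p * (R - 1))\<close>. From above, \<open>G R \<le> exp (C * R powr \<theta>)\<close> for every
  \<open>\<theta> > 1 / \<kappa>\<close>, and \<open>E m \<le> G R / R ^ m\<close> with \<open>R = m powr (1 / \<theta>)\<close> is the upper bound. From below, the
  primes up to \<open>y\<close> alone give \<open>G (1 + 2 * y ^ \<kappa>) \<ge> 2 ^ \<pi>(y)\<close>. If \<open>E m\<close> were at most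
  \<open>m powr (- (\<kappa> + \<epsilon>) * m)\<close> for all large \<open>m\<close>, then \<open>ln (G R)\<close> would be
  \<open>O(R powr (1 / (\<kappa> + \<epsilon>)) * ln R)\<close>, hence \<open>\<pi>(y) \<le> y powr \<alpha>\<close> for some \<open>\<alpha> < 1\<close> and all large \<open>y\<close>, which
  would make \<open>\<Sum> 1 / p\<close> converge.

  The divergence of \<open>\<Sum> 1 / p\<close> is a further instance of the same theory: if the sum converged,
  \<open>J = {1..}\<close> would be admissible with \<open>\<kappa> = 1\<close>, and the density of the integers without prime factor
  would be the nonzero number \<open>\<Prod>p. 1 - 1 / p\<close>, although \<open>1\<close> is the only such integer.
\<close>

section \<open>Natural density along the integers\<close>

definition count_upto :: "nat set \<Rightarrow> nat \<Rightarrow> nat" where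
  "count_upto A N = card {n \<in> A. 1 \<le> n \<and> n \<le> N}"

definition seq_density :: "nat set \<Rightarrow> real \<Rightarrow> bool" where
  "seq_density A d \<longleftrightarrow> (\<lambda>N. real (count_upto A N) / real N) \<longlonglongrightarrow> d"

lemma finite_count_upto [simp]: "finite {n \<in> A. 1 \<le> n \<and> n \<le> (N::nat)}"
  by (rule finite_subset[of _ "{..N}"]) auto

lemma count_upto_0 [simp]: "count_upto A 0 = 0"
  by (auto simp: count_upto_def)

lemma count_upto_le: "count_upto A N \<le> N"
proof -
  have "card {n \<in> A. 1 \<le> n \<and> n \<le> N} \<le> card {1..N}" by (rule card_mono) auto
  then show ?thesis by (simp add: count_upto_def)
qed

lemma count_upto_cong:
  "(\<And>n. n \<ge> 1 \<Longrightarrow> n \<in> A \<longleftrightarrow> n \<in> B) \<Longrightarrow> count_upto A N = count_upto B N"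
  unfolding count_upto_def by (rule arg_cong[where f = card]) auto

lemma seq_density_cong:
  "(\<And>n. n \<ge> 1 \<Longrightarrow> n \<in> A \<longleftrightarrow> n \<in> B) \<Longrightarrow> seq_density A d \<longleftrightarrow> seq_density B d"
  using count_upto_cong[of A B] by (simp add: seq_density_def)

lemma count_upto_disjoint:
  assumes "A \<inter> B = {}"
  shows "count_upto (A \<union> B) N = count_upto A N + count_upto B N"
proof -
  have "{n \<in> A \<union> B. 1 \<le> n \<and> n \<le> N} = {n \<in> A. 1 \<le> n \<and> n \<le> N} \<union> {n \<in> B. 1 \<le> n \<and> n \<le> N}" by auto
  then show ?thesis unfolding count_upto_def using assms by (simp only:) (rule card_Un_disjoint, auto)
qed

lemma seq_density_disjoint:
  assumes "seq_density A a" "seq_density B b" "A \<inter> B = {}"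
  shows "seq_density (A \<union> B) (a + b)"
  using tendsto_add[OF assms(1,2)[unfolded seq_density_def]]
  by (simp add: seq_density_def count_upto_disjoint[OF assms(3)] add_divide_distrib)

lemma seq_density_nonneg:
  assumes "seq_density A d"
  shows "0 \<le> d"
proof (rule tendsto_lowerbound)
  show "(\<lambda>N. real (count_upto A N) / real N) \<longlonglongrightarrow> d"
    using assms by (simp add: seq_density_def)
qed auto

text \<open>
  Pass from integers \<open>N\<close> to real \<open>x\<close>: \<open>\<lfloor>x\<rfloor> / x\<close> tends to \<open>1\<close>.
\<close>
lemma seq_density_imp_natural:
  assumes "seq_density A d"
  shows "has_natural_density A d"
proof -
  have fl: "filterlim (\<lambda>x::real. nat \<lfloor>x\<rfloor>) sequentially at_top"
    by (intro filterlim_compose[OF filterlim_nat_sequentially filterlim_floor_sequentially])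
  have 1: "((\<lambda>x::real. real (count_upto A (nat \<lfloor>x\<rfloor>)) / real (nat \<lfloor>x\<rfloor>)) \<longlongrightarrow> d) at_top"
    using assms fl unfolding seq_density_def by (rule filterlim_compose)
  have 2: "((\<lambda>x::real. real (nat \<lfloor>x\<rfloor>) / x) \<longlongrightarrow> 1) at_top"
  proof (rule tendsto_sandwich)
    show "\<forall>\<^sub>F x in at_top. 1 - 1 / x \<le> real (nat \<lfloor>x\<rfloor>) / x"
      using eventually_gt_at_top[of "0::real"]
    proof eventually_elim
      case (elim x)
      then have "x - 1 \<le> real (nat \<lfloor>x\<rfloor>)" by linarith
      then have "(x - 1) / x \<le> real (nat \<lfloor>x\<rfloor>) / x"
        using elim by (intro divide_right_mono) auto
      then show ?case using elim by (simp add: diff_divide_distrib)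
    qed
    show "\<forall>\<^sub>F x in at_top. real (nat \<lfloor>x\<rfloor>) / x \<le> 1"
      using eventually_gt_at_top[of "0::real"]
      by eventually_elim (simp add: divide_le_eq)
    have "((\<lambda>x::real. 1 / x) \<longlongrightarrow> 0) at_top"
      by (rule tendsto_divide_0[OF tendsto_const filterlim_at_top_imp_at_infinity[OF filterlim_ident]])
    from tendsto_diff[OF tendsto_const this, of "1::real"]
    show "((\<lambda>x::real. 1 - 1 / x) \<longlongrightarrow> 1) at_top" by simp
  qed auto
  have "((\<lambda>x::real. real (count_upto A (nat \<lfloor>x\<rfloor>)) / real (nat \<lfloor>x\<rfloor>) * (real (nat \<lfloor>x\<rfloor>) / x)) \<longlongrightarrow> d * 1) at_top"
    by (rule tendsto_mult[OF 1 2])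
  moreover have "\<forall>\<^sub>F x::real in at_top. real (count_upto A (nat \<lfloor>x\<rfloor>)) / real (nat \<lfloor>x\<rfloor>) * (real (nat \<lfloor>x\<rfloor>) / x)
      = real (card {n \<in> A. 1 \<le> n \<and> real n \<le> x}) / x"
    using eventually_ge_at_top[of "1::real"]
  proof eventually_elim
    case (elim x)
    have "n \<le> nat \<lfloor>x\<rfloor> \<longleftrightarrow> real n \<le> x" for n using elim by linarith
    moreover have "real (nat \<lfloor>x\<rfloor>) \<noteq> 0" using elim by linarith
    ultimately show ?case by (simp add: count_upto_def del: of_nat_eq_0_iff)
  qed
  ultimately have "((\<lambda>x::real. real (card {n \<in> A. 1 \<le> n \<and> real n \<le> x}) / x) \<longlongrightarrow> d * 1) at_top"
    by (rule tendsto_cong[THEN iffD1, rotated])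
  then show ?thesis unfolding has_natural_density_def by simp
qed

lemma natural_density_eq:
  assumes "has_natural_density A d"
  shows "natural_density A = d"
  unfolding natural_density_def
proof (rule the_equality)
  show "has_natural_density A d" by (rule assms)
  fix d' assume "has_natural_density A d'"
  then show "d' = d" using assms unfolding has_natural_density_def
    by (rule tendsto_unique[rotated]) simp
qed

lemma seq_density_div:
  assumes "seq_density A d" "q \<ge> 1"
  shows "(\<lambda>N. real (count_upto A (N div q)) / real N) \<longlonglongrightarrow> d / real q"
proof -
  have fl: "filterlim (\<lambda>N. N div q) sequentially sequentially"
    unfolding filterlim_at_top
  proof
    fix Z :: nat
    show "\<forall>\<^sub>F N in sequentially. Z \<le> N div q"
      using eventually_ge_at_top[of "Z * q"]
      by eventually_elim (use assms(2) in \<open>simp add: less_eq_div_iff_mult_less_eq\<close>)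
  qed
  have 1: "(\<lambda>N. real (count_upto A (N div q)) / real (N div q)) \<longlonglongrightarrow> d"
    using assms(1) fl unfolding seq_density_def by (rule filterlim_compose)
  have 2: "(\<lambda>N. real (N div q) / real N) \<longlonglongrightarrow> 1 / real q"
  proof (rule tendsto_sandwich)
    show "\<forall>\<^sub>F N in sequentially. 1 / real q - 1 / real N \<le> real (N div q) / real N"
      using eventually_gt_at_top[of "0::nat"]
    proof eventually_elim
      case (elim N)
      have "real N / real q - 1 \<le> real (N div q)"
        using floor_divide_of_nat_eq[of N q, where 'a = real] by linarith
      then have "(real N / real q - 1) / real N \<le> real (N div q) / real N"
        by (rule divide_right_mono) simp
      then show ?case using elim by (simp add: diff_divide_distrib)
    qed
    show "\<forall>\<^sub>F N in sequentially. real (N div q) / real N \<le> 1 / real q"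
      using eventually_gt_at_top[of "0::nat"]
    proof eventually_elim
      case (elim N)
      have "real (N div q) / real N \<le> (real N / real q) / real N"
        by (rule divide_right_mono[OF of_nat_div_le_of_nat]) simp
      then show ?case using elim by simp
    qed
    show "(\<lambda>N. 1 / real q - 1 / real N) \<longlonglongrightarrow> 1 / real q"
      using tendsto_diff[OF tendsto_const lim_1_over_n, of "1 / real q"] by simp
  qed auto
  have "(\<lambda>N. real (count_upto A (N div q)) / real (N div q) * (real (N div q) / real N)) \<longlonglongrightarrow> d * (1 / real q)"
    by (rule tendsto_mult[OF 1 2])
  moreover have "real (count_upto A (N div q)) / real (N div q) * (real (N div q) / real N)
      = real (count_upto A (N div q)) / real N" for N
    by (cases "N div q = 0") auto
  ultimately show ?thesis by (simp only:) simp
qed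

lemma count_upto_dvd:
  assumes "\<And>n. n \<ge> 1 \<Longrightarrow> q * n \<in> A \<longleftrightarrow> n \<in> A" "q \<ge> 1"
  shows "count_upto {n \<in> A. q dvd n} N = count_upto A (N div q)"
proof -
  have "bij_betw (\<lambda>n. q * n) {n \<in> A. 1 \<le> n \<and> n \<le> N div q} {n \<in> {n \<in> A. q dvd n}. 1 \<le> n \<and> n \<le> N}"
    unfolding bij_betw_def
  proof
    show "inj_on (\<lambda>n. q * n) {n \<in> A. 1 \<le> n \<and> n \<le> N div q}"
      using assms(2) by (auto intro: inj_onI)
    show "(\<lambda>n. q * n) ` {n \<in> A. 1 \<le> n \<and> n \<le> N div q} = {n \<in> {n \<in> A. q dvd n}. 1 \<le> n \<and> n \<le> N}"
    proof (intro equalityI subsetI)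
      fix x assume "x \<in> (\<lambda>n. q * n) ` {n \<in> A. 1 \<le> n \<and> n \<le> N div q}"
      then obtain n where n: "x = q * n" "n \<in> A" "1 \<le> n" "n \<le> N div q" by auto
      then have "q * n \<le> N" using assms(2)
        by (metis less_eq_div_iff_mult_less_eq mult.commute less_le_trans zero_less_one)
      then show "x \<in> {n \<in> {n \<in> A. q dvd n}. 1 \<le> n \<and> n \<le> N}"
        using n assms by (auto simp: Suc_le_eq)
    next
      fix x assume x: "x \<in> {n \<in> {n \<in> A. q dvd n}. 1 \<le> n \<and> n \<le> N}"
      then obtain n where n: "x = q * n" by auto
      then have "n \<ge> 1" using x by (cases n) auto
      moreover have "n \<le> N div q" using x n assms(2)
        by (simp add: less_eq_div_iff_mult_less_eq mult.commute)
      moreover have "n \<in> A" using assms(1)[OF \<open>n \<ge> 1\<close>] x n by auto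
      ultimately show "x \<in> (\<lambda>n. q * n) ` {n \<in> A. 1 \<le> n \<and> n \<le> N div q}" using n by auto
    qed
  qed
  from bij_betw_same_card[OF this] show ?thesis by (simp add: count_upto_def)
qed

section \<open>Independence of the valuations at different primes\<close>

text \<open>
  The density of the integers whose \<open>p\<close>-adic valuation lies in \<open>J\<close>, since valuation exactly \<open>j\<close> has
  density \<open>(1 - 1 / p) / p ^ j\<close>.
\<close>
definition mult_density :: "nat set \<Rightarrow> nat \<Rightarrow> real" where
  "mult_density J p = (\<Sum>j. if j \<in> J then (1 - 1 / real p) * (1 / real p) ^ j else 0)"

lemma summable_mult_density:
  assumes "prime p"
  shows "summable (\<lambda>j. if j \<in> J then (1 - 1 / real p) * (1 / real p) ^ j else 0)"
proof (rule summable_comparison_test')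
  show "summable (\<lambda>j. (1 / real p) ^ j)"
    using prime_gt_1_nat[OF assms] by (intro summable_geometric) auto
  show "norm (if j \<in> J then (1 - 1 / real p) * (1 / real p) ^ j else 0) \<le> (1 / real p) ^ j" for j
    using prime_gt_1_nat[OF assms] by (auto simp: abs_mult mult_le_cancel_right1)
qed

text \<open>
  Invariance of \<open>A\<close> under multiplication by \<open>p\<close> expresses that membership does not depend on the
  valuation at \<open>p\<close>. It makes \<open>n \<mapsto> p ^ j * n\<close> a bijection from the elements of \<open>A\<close> up to \<open>N / p ^ j\<close> onto
  the multiples of \<open>p ^ j\<close> in \<open>A\<close> up to \<open>N\<close>, so that valuation exactly \<open>j\<close> is counted by a difference of
  two values of the counting function of \<open>A\<close>. The \<open>j\<close>-th term is at most \<open>p\<^sup>-\<^sup>j\<close> after division by \<open>N\<close>,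
  so the sum over the possibly infinite \<open>J\<close> commutes with the limit by Tannery's theorem.
\<close>
lemma density_multiplicity_in:
  assumes A: "seq_density A d" and inv: "\<And>n. n \<ge> 1 \<Longrightarrow> p * n \<in> A \<longleftrightarrow> n \<in> A" and p: "prime p"
  shows "seq_density {n \<in> A. multiplicity p n \<in> J} (d * mult_density J p)"
proof -
  have p2: "p \<ge> 2" using p by (rule prime_ge_2_nat)
  define a where "a j N = (if j \<in> J then
     (real (count_upto A (N div p ^ j)) - real (count_upto A (N div p ^ Suc j))) / real N else 0)" for j N
  define b where "b j = (if j \<in> J then d / real (p ^ j) - d / real (p ^ Suc j) else 0)" for j
  have inv': "p ^ j * n \<in> A \<longleftrightarrow> n \<in> A" if "n \<ge> 1" for n j
    using inv that p2 by (induction j) (auto simp: mult.assoc)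
  have level: "count_upto {n \<in> A. multiplicity p n = j} N + count_upto A (N div p ^ Suc j)
      = count_upto A (N div p ^ j)" for j N
  proof -
    have "count_upto A (N div p ^ j) = count_upto {n \<in> A. p ^ j dvd n} N"
      by (rule count_upto_dvd[symmetric], erule inv') (use p2 in simp)
    also have "\<dots> = count_upto ({n \<in> A. n \<ge> 1 \<and> multiplicity p n = j} \<union> {n \<in> A. p ^ Suc j dvd n}) N"
    proof (rule count_upto_cong)
      fix n :: nat assume "n \<ge> 1"
      then have dvd: "p ^ i dvd n \<longleftrightarrow> i \<le> multiplicity p n" for i
        using p power_dvd_iff_le_multiplicity[of n p i] not_prime_unit by auto
      show "n \<in> {n \<in> A. p ^ j dvd n} \<longleftrightarrow>
          n \<in> {n \<in> A. n \<ge> 1 \<and> multiplicity p n = j} \<union> {n \<in> A. p ^ Suc j dvd n}"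
        unfolding Un_iff mem_Collect_eq dvd using \<open>n \<ge> 1\<close> by linarith
    qed
    also have "\<dots> = count_upto {n \<in> A. n \<ge> 1 \<and> multiplicity p n = j} N + count_upto {n \<in> A. p ^ Suc j dvd n} N"
    proof (rule count_upto_disjoint)
      have False if "n \<ge> 1" "p ^ Suc (multiplicity p n) dvd n" for n
        using that p power_dvd_iff_le_multiplicity[of n p "Suc (multiplicity p n)"] not_prime_unit
        by auto
      then show "{n \<in> A. n \<ge> 1 \<and> multiplicity p n = j} \<inter> {n \<in> A. p ^ Suc j dvd n} = {}"
        by blast
    qed
    also have "count_upto {n \<in> A. p ^ Suc j dvd n} N = count_upto A (N div p ^ Suc j)"
      by (rule count_upto_dvd, erule inv') (use p2 in simp)
    also have "count_upto {n \<in> A. n \<ge> 1 \<and> multiplicity p n = j} N = count_upto {n \<in> A. multiplicity p n = j} N"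
      by (rule count_upto_cong) auto
    finally show ?thesis by simp
  qed
  have count: "(\<Sum>j. a j N) = real (count_upto {n \<in> A. multiplicity p n \<in> J} N) / real N" for N
  proof -
    have small: "j < p ^ j" for j using p2 less_exp[of j] power_mono[of 2 p j] by linarith
    have "(\<Sum>j. a j N) = (\<Sum>j\<le>N. a j N)"
    proof (rule suminf_finite)
      fix j assume "j \<notin> {..N}"
      then have "N < p ^ j" using small[of j] by auto
      moreover have "N < p ^ Suc j" using \<open>N < p ^ j\<close> p2 by (simp add: less_le_trans[of _ "p ^ j"])
      ultimately show "a j N = 0" by (simp add: a_def)
    qed simp
    also have "\<dots> = (\<Sum>j\<in>{..N} \<inter> J. real (count_upto {n \<in> A. multiplicity p n = j} N) / real N)"
      unfolding sum.inter_restrict[OF finite_atMost]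
      by (intro sum.cong refl) (use level in \<open>simp add: a_def flip: level of_nat_add\<close>)
    also have "\<dots> = real (\<Sum>j\<in>{..N} \<inter> J. count_upto {n \<in> A. multiplicity p n = j} N) / real N"
      by (simp add: sum_divide_distrib)
    also have "(\<Sum>j\<in>{..N} \<inter> J. count_upto {n \<in> A. multiplicity p n = j} N)
        = count_upto {n \<in> A. multiplicity p n \<in> J} N"
      unfolding count_upto_def
    proof (subst card_UN_disjoint[symmetric])
      have "multiplicity p n \<le> N" if "1 \<le> n" "n \<le> N" for n
      proof -
        have "p ^ multiplicity p n \<le> n" using that by (intro dvd_imp_le multiplicity_dvd) auto
        then show ?thesis using small[of "multiplicity p n"] that by linarith
      qed
      then show "card (\<Union>j\<in>{..N} \<inter> J. {n \<in> {n \<in> A. multiplicity p n = j}. 1 \<le> n \<and> n \<le> N})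
          = card {n \<in> {n \<in> A. multiplicity p n \<in> J}. 1 \<le> n \<and> n \<le> N}"
        by (intro arg_cong[where f = card]) auto
    qed auto
    finally show ?thesis .
  qed
  have "(\<lambda>N. \<Sum>j. a j N) \<longlonglongrightarrow> (\<Sum>j. b j)"
  proof (rule tannerys_theorem[THEN conjunct2, THEN conjunct2])
    show "(\<lambda>N. a j N) \<longlonglongrightarrow> b j" for j
    proof (cases "j \<in> J")
      case True
      show ?thesis unfolding a_def b_def using True p2
        by (simp only: if_True diff_divide_distrib) (intro tendsto_diff seq_density_div[OF A], auto)
    qed (simp add: a_def b_def)
    have "norm (a j N) \<le> (1 / real p) ^ j" for j N
    proof -
      have "real (count_upto A (N div p ^ j)) \<le> real N / real p ^ j"
        using order_trans[OF of_nat_mono[OF count_upto_le] of_nat_div_le_of_nat[of N "p ^ j"]] by simp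
      then have "real (count_upto A (N div p ^ j)) / real N \<le> (real N / real p ^ j) / real N"
        by (rule divide_right_mono) simp
      also have "\<dots> \<le> (1 / real p) ^ j" by (cases "N = 0") (auto simp: field_simps)
      finally have *: "real (count_upto A (N div p ^ j)) / real N \<le> (1 / real p) ^ j" .
      have "real (count_upto A (N div p ^ Suc j)) \<le> real (count_upto A (N div p ^ j))"
        using level[of j N] by simp
      then have "norm (a j N) \<le> real (count_upto A (N div p ^ j)) / real N"
        by (auto simp: a_def intro!: divide_right_mono)
      with * show ?thesis by linarith
    qed
    then show "\<forall>\<^sub>F (j, N) in at_top \<times>\<^sub>F sequentially. norm (a j N) \<le> (1 / real p) ^ j"
      by (intro always_eventually) auto
    show "summable (\<lambda>j. (1 / real p) ^ j)" using p2 by (intro summable_geometric) auto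
  qed simp
  moreover have "(\<Sum>j. b j) = d * mult_density J p"
  proof -
    have "b j = d * (if j \<in> J then (1 - 1 / real p) * (1 / real p) ^ j else 0)" for j
      using p2 by (simp add: b_def field_simps)
    then show ?thesis
      by (simp add: mult_density_def suminf_mult summable_mult_density[OF p])
  qed
  ultimately show ?thesis unfolding seq_density_def by (simp add: count)
qed

section \<open>Finitely many primes: the Poisson binomial law\<close>

text \<open>
  The probability that exactly \<open>m\<close> of \<open>Y\<close> independent events with probabilities
  \<open>c 0, \<dots>, c (Y - 1)\<close> occur.
\<close>
primrec poisson_binomial :: "(nat \<Rightarrow> real) \<Rightarrow> nat \<Rightarrow> nat \<Rightarrow> real" where
  "poisson_binomial c 0 m = (if m = 0 then 1 else 0)"
| "poisson_binomial c (Suc Y) m = (1 - c Y) * poisson_binomial c Y m +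
     c Y * (case m of 0 \<Rightarrow> 0 | Suc m' \<Rightarrow> poisson_binomial c Y m')"

lemma poisson_binomial_sums:
  fixes z :: "'a :: real_normed_field"
  shows "(\<lambda>m. of_real (poisson_binomial c Y m) * z ^ m) sums (\<Prod>p<Y. 1 + of_real (c p) * (z - 1))"
proof (induction Y)
  case 0
  have "(\<lambda>m. if m = 0 then 1 else 0 :: 'a) sums 1" by (rule sums_single[of 0 "\<lambda>_. 1", simplified])
  then show ?case by (simp add: if_distrib[of of_real] if_distrib[of "\<lambda>x. x * _"] cong: if_cong)
next
  case (Suc Y)
  let ?P = "\<Prod>p<Y. 1 + of_real (c p) * (z - 1)"
  have 1: "(\<lambda>m. of_real (1 - c Y) * (of_real (poisson_binomial c Y m) * z ^ m)) sums (of_real (1 - c Y) * ?P)"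
    by (rule sums_mult[OF Suc.IH])
  have "(\<lambda>m. (of_real (c Y) * z) * (of_real (poisson_binomial c Y m) * z ^ m)) sums (of_real (c Y) * z * ?P)"
    by (rule sums_mult[OF Suc.IH])
  then have "(\<lambda>m. of_real (c Y) * of_real (case Suc m of 0 \<Rightarrow> 0 | Suc m' \<Rightarrow> poisson_binomial c Y m') * z ^ Suc m)
      sums (of_real (c Y) * z * ?P)"
    by (rule sums_cong[THEN iffD1, rotated]) simp
  then have 2: "(\<lambda>m. of_real (c Y) * of_real (case m of 0 \<Rightarrow> 0 | Suc m' \<Rightarrow> poisson_binomial c Y m') * z ^ m)
      sums (of_real (c Y) * z * ?P)"
    by (subst (asm) sums_Suc_iff) simp
  have "of_real (1 - c Y) * ?P + of_real (c Y) * z * ?P = (\<Prod>p<Suc Y. 1 + of_real (c p) * (z - 1))"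
    by (simp add: algebra_simps)
  with sums_add[OF 1 2] show ?case
    by (simp add: algebra_simps)
qed

lemma poisson_binomial_nonneg:
  assumes "\<And>p. 0 \<le> c p" "\<And>p. c p \<le> 1"
  shows "0 \<le> poisson_binomial c Y m"
  by (induction Y arbitrary: m) (auto intro!: add_nonneg_nonneg mult_nonneg_nonneg assms simp: assms split: nat.split)

definition prime_count :: "nat set \<Rightarrow> nat \<Rightarrow> nat" where
  "prime_count J n = card {p. prime p \<and> multiplicity p n \<in> J}"

definition prime_count_below :: "nat set \<Rightarrow> nat \<Rightarrow> nat \<Rightarrow> nat" where
  "prime_count_below J Y n = card {p. p < Y \<and> prime p \<and> multiplicity p n \<in> J}"

text \<open>
  The value \<open>0\<close> at non-primes lets products and sums run over all natural numbers.
\<close>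
definition prime_density :: "nat set \<Rightarrow> nat \<Rightarrow> real" where
  "prime_density J p = (if prime p then mult_density J p else 0)"

lemma finite_below [simp]: "finite {p. p < (Y::nat) \<and> Q p}"
  by (rule finite_subset[of _ "{..<Y}"]) auto

lemma prime_count_below_Suc:
  "prime_count_below J (Suc Y) n =
     prime_count_below J Y n + (if prime Y \<and> multiplicity Y n \<in> J then 1 else 0)"
proof (cases "prime Y \<and> multiplicity Y n \<in> J")
  case True
  have "{p. p < Suc Y \<and> prime p \<and> multiplicity p n \<in> J} =
      insert Y {p. p < Y \<and> prime p \<and> multiplicity p n \<in> J}"
    using True by (auto simp: less_Suc_eq)
  then show ?thesis using True by (simp add: prime_count_below_def)
next
  case False
  then have "{p. p < Suc Y \<and> prime p \<and> multiplicity p n \<in> J} =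
      {p. p < Y \<and> prime p \<and> multiplicity p n \<in> J}"
    by (auto simp: less_Suc_eq)
  then show ?thesis using False by (auto simp add: prime_count_below_def)
qed

lemma prime_count_below_times:
  assumes "prime p" "Y \<le> p" "n \<ge> 1"
  shows "prime_count_below J Y (p * n) = prime_count_below J Y n"
proof -
  have "multiplicity q (p * n) = multiplicity q n" if "q < Y" "prime q" for q
    using assms that primes_dvd_imp_eq[of q p] by (intro multiplicity_prime_elem_times_other) auto
  then have "{q. q < Y \<and> prime q \<and> multiplicity q (p * n) \<in> J} = {q. q < Y \<and> prime q \<and> multiplicity q n \<in> J}"
    by auto
  then show ?thesis by (simp add: prime_count_below_def)
qed

lemma seq_density_Diff:
  assumes "seq_density A a" "seq_density B b" "B \<subseteq> A"
  shows "seq_density (A - B) (a - b)"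
proof -
  have "count_upto A N = count_upto (A - B) N + count_upto B N" for N
    using count_upto_disjoint[of "A - B" B] assms(3) by (simp add: Un_absorb2 Int_commute)
  then have "(\<lambda>N. real (count_upto (A - B) N) / real N)
      = (\<lambda>N. real (count_upto A N) / real N - real (count_upto B N) / real N)"
    by (simp add: add_divide_distrib)
  then show ?thesis using tendsto_diff[OF assms(1,2)[unfolded seq_density_def]]
    by (simp add: seq_density_def)
qed

lemma seq_density_empty: "seq_density {} 0"
  by (simp add: seq_density_def count_upto_def)

lemma seq_density_UNIV: "seq_density UNIV 1"
proof -
  have "{n. 1 \<le> n \<and> n \<le> N} = {1..N}" for N :: nat by auto
  then have "\<forall>\<^sub>F N in sequentially. 1 = real (count_upto UNIV N) / real N"
    by (intro eventually_sequentiallyI[of 1]) (simp add: count_upto_def)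
  then show ?thesis unfolding seq_density_def by (rule tendsto_cong[THEN iffD1]) simp
qed

text \<open>
  Among the integers with a given count below \<open>Y\<close>, a set that is invariant under multiplication by
  the prime \<open>Y\<close>, the valuation at \<open>Y\<close> lies in \<open>J\<close> with relative density \<open>mult_density J Y\<close>. This is the
  recursion of the Poisson binomial law.
\<close>
lemma density_prime_count_below:
  "seq_density {n. prime_count_below J Y n = m} (poisson_binomial (prime_density J) Y m)"
proof (induction Y arbitrary: m)
  case 0
  then show ?case
    by (cases "m = 0") (simp_all add: prime_count_below_def seq_density_empty seq_density_UNIV)
next
  case (Suc Y)
  let ?pb = "poisson_binomial (prime_density J)"
  define A where "A m = {n. prime_count_below J Y n = m}" for m
  show ?case
  proof (cases "prime Y")
    case False
    then show ?thesis using Suc.IH[of m] by (simp add: prime_count_below_Suc prime_density_def)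
  next
    case True
    define B where "B m = {n \<in> A m. multiplicity Y n \<in> J}" for m
    have A: "seq_density (A m) (?pb Y m)" for m using Suc.IH by (simp add: A_def)
    have B: "seq_density (B m) (?pb Y m * mult_density J Y)" for m
      unfolding B_def by (rule density_multiplicity_in[OF A _ True])
        (simp add: A_def prime_count_below_times True)
    have AB: "seq_density (A m - B m) (?pb Y m - ?pb Y m * mult_density J Y)" for m
      by (rule seq_density_Diff[OF A B]) (auto simp: B_def)
    show ?thesis
    proof (cases m)
      case 0
      have "{n. prime_count_below J (Suc Y) n = m} = A m - B m"
        using True 0 by (auto simp: prime_count_below_Suc A_def B_def)
      moreover have "prime_density J Y = mult_density J Y" using True by (simp add: prime_density_def)
      ultimately show ?thesis using AB[of m] 0 by (simp add: algebra_simps)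
    next
      case (Suc m')
      have "{n. prime_count_below J (Suc Y) n = m} = (A m - B m) \<union> B m'"
        using True Suc by (auto simp: prime_count_below_Suc A_def B_def split: if_splits)
      moreover have "seq_density ((A m - B m) \<union> B m')
          (?pb Y m - ?pb Y m * mult_density J Y + ?pb Y m' * mult_density J Y)"
        by (rule seq_density_disjoint[OF AB B]) (auto simp: A_def B_def Suc)
      moreover have "prime_density J Y = mult_density J Y" using True by (simp add: prime_density_def)
      ultimately show ?thesis using Suc by (simp add: algebra_simps)
    qed
  qed
qed

section \<open>All primes: existence of the densities and their generating function\<close>

text \<open>
  The approximation of \<open>a\<close> by \<open>b Y\<close> is uniform, so \<open>a\<close> inherits the Cauchy property from any \<open>b Y\<close>;
  convergence of \<open>d\<close> is then a consequence and need not be known beforehand.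
\<close>
lemma limits_interchange:
  fixes a t d :: "nat \<Rightarrow> real" and b :: "nat \<Rightarrow> nat \<Rightarrow> real"
  assumes close: "\<And>Y N. \<bar>a N - b Y N\<bar> \<le> t Y" and b: "\<And>Y. b Y \<longlonglongrightarrow> d Y" and t: "t \<longlonglongrightarrow> 0"
  obtains l where "a \<longlonglongrightarrow> l" "d \<longlonglongrightarrow> l"
proof -
  have "Cauchy a"
  proof (rule CauchyI)
    fix \<epsilon> :: real assume "\<epsilon> > 0"
    then have "\<forall>\<^sub>F Y in sequentially. t Y < \<epsilon> / 3" by (intro order_tendstoD(2)[OF t]) auto
    then obtain Y where Y: "t Y < \<epsilon> / 3" by (auto simp: eventually_sequentially)
    have "Cauchy (b Y)" using b[of Y] by (rule LIMSEQ_imp_Cauchy)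
    then obtain M where M: "\<forall>m\<ge>M. \<forall>n\<ge>M. norm (b Y m - b Y n) < \<epsilon> / 3"
      using \<open>\<epsilon> > 0\<close> by (meson CauchyD divide_pos_pos zero_less_numeral)
    have "norm (a m - a n) < \<epsilon>" if "m \<ge> M" "n \<ge> M" for m n
      using M[rule_format, OF that] close[of m Y] close[of n Y] Y unfolding real_norm_def by argo
    then show "\<exists>M. \<forall>m\<ge>M. \<forall>n\<ge>M. norm (a m - a n) < \<epsilon>" by blast
  qed
  then obtain l where l: "a \<longlonglongrightarrow> l" using Cauchy_convergent convergentD by blast
  have "\<bar>l - d Y\<bar> \<le> t Y" for Y
  proof (rule tendsto_upperbound)
    show "(\<lambda>N. \<bar>a N - b Y N\<bar>) \<longlonglongrightarrow> \<bar>l - d Y\<bar>" by (intro tendsto_intros l b)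
  qed (use close in auto)
  then have "(\<lambda>Y. l - d Y) \<longlonglongrightarrow> 0"
    by (intro Lim_null_comparison[OF _ t]) (auto intro!: always_eventually)
  from tendsto_diff[OF tendsto_const[of l] this] have "d \<longlonglongrightarrow> l" by simp
  with l show thesis by (rule that)
qed

definition prime_power_weight :: "nat \<Rightarrow> nat \<Rightarrow> real" where
  "prime_power_weight \<kappa> p = (if prime p then 1 / real p ^ \<kappa> else 0)"

text \<open>
  Summability of the weights is assumed instead of \<open>\<kappa> \<ge> 2\<close>, which implies it, so that the case
  \<open>\<kappa> = 1\<close> can be refuted from within the locale in \<open>not_summable_prime_reciprocals\<close>.
\<close>
locale exponent_set =
  fixes J :: "nat set" and \<kappa> :: nat
  assumes least_mem: "\<kappa> \<in> J" and least: "\<And>j. j \<in> J \<Longrightarrow> \<kappa> \<le> j" and pos: "\<kappa> \<ge> 1"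
    and summable_weight: "summable (prime_power_weight \<kappa>)"
begin

abbreviation c :: "nat \<Rightarrow> real" where "c \<equiv> prime_density J"

text \<open>
  Enlarging \<open>J\<close> to \<open>{\<kappa>..}\<close> gives the density of the multiples of \<open>p ^ \<kappa>\<close>.
\<close>
lemma density_le: "c p \<le> prime_power_weight \<kappa> p"
proof (cases "prime p")
  case True
  have p: "real p > 1" using prime_gt_1_nat[OF True] by simp
  define r where "r = 1 / real p"
  have r: "0 < r" "r < 1" using p by (auto simp: r_def)
  have "(\<lambda>j. (1 - r) * r ^ \<kappa> * r ^ j) sums ((1 - r) * r ^ \<kappa> * (1 / (1 - r)))"
    using r by (intro sums_mult geometric_sums) auto
  then have "(\<lambda>j. if j + \<kappa> < \<kappa> then 0 else (1 - r) * r ^ (j + \<kappa>)) sums (r ^ \<kappa>)"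
    using r by (simp add: power_add mult_ac)
  then have g: "(\<lambda>j. if j < \<kappa> then 0 else (1 - r) * r ^ j) sums (r ^ \<kappa>)"
    using sums_iff_shift[of "\<lambda>j. if j < \<kappa> then 0 else (1 - r) * r ^ j" \<kappa> "r ^ \<kappa>"] by simp
  have "mult_density J p \<le> (\<Sum>j. if j < \<kappa> then 0 else (1 - r) * r ^ j)"
    unfolding mult_density_def
  proof (rule suminf_le)
    show "(if j \<in> J then (1 - 1 / real p) * (1 / real p) ^ j else 0) \<le> (if j < \<kappa> then 0 else (1 - r) * r ^ j)" for j
      using least[of j] r by (auto simp: r_def)
  qed (use summable_mult_density[OF True] g in \<open>auto simp: sums_iff\<close>)
  also have "\<dots> = r ^ \<kappa>" using g by (simp add: sums_iff)
  finally show ?thesis using True by (simp add: prime_density_def prime_power_weight_def r_def power_divide)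
qed (simp add: prime_density_def prime_power_weight_def)

text \<open>
  The single exponent \<open>\<kappa>\<close> already contributes \<open>(1 - 1 / p) / p ^ \<kappa>\<close>.
\<close>
lemma density_ge:
  assumes "prime p"
  shows "1 / (2 * real p ^ \<kappa>) \<le> c p"
proof -
  have p: "real p \<ge> 2" using prime_ge_2_nat[OF assms] by simp
  have "1 / 2 * (1 / real p) ^ \<kappa> \<le> (1 - 1 / real p) * (1 / real p) ^ \<kappa>"
    using p by (intro mult_right_mono) (auto simp: field_simps)
  also have "\<dots> = (\<Sum>j\<in>{\<kappa>}. if j \<in> J then (1 - 1 / real p) * (1 / real p) ^ j else 0)"
    using least_mem by simp
  also have "\<dots> \<le> mult_density J p"
    unfolding mult_density_def using p
    by (intro sum_le_suminf summable_mult_density[OF assms]) auto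
  finally show ?thesis using assms by (simp add: prime_density_def power_divide)
qed

lemma weight_le_1: "prime_power_weight \<kappa> p \<le> 1"
  by (auto simp: prime_power_weight_def divide_le_eq dest: prime_gt_0_nat)

lemma weight_nonneg: "0 \<le> prime_power_weight \<kappa> p"
  by (auto simp: prime_power_weight_def)

lemma density_nonneg: "0 \<le> c p"
proof (cases "prime p")
  case True
  have "0 \<le> 1 / (2 * real p ^ \<kappa>)" by simp
  with density_ge[OF True] show ?thesis by linarith
qed (simp add: prime_density_def)

lemma density_le_1: "c p \<le> 1"
  using density_le[of p] weight_le_1[of p] by linarith

lemma summable_density: "summable c"
  by (rule summable_comparison_test'[OF summable_weight, of 0]) (use density_nonneg density_le in auto)

text \<open>
  The two counts can differ only at an \<open>n\<close> with a prime \<open>p \<ge> Y\<close> whose valuation lies in \<open>J\<close>, and such an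
  \<open>n\<close> is a multiple of \<open>p ^ \<kappa>\<close>.
\<close>
lemma count_differ:
  "\<bar>real (count_upto {n. prime_count J n = m} N) / real N
     - real (count_upto {n. prime_count_below J Y n = m} N) / real N\<bar>
   \<le> (\<Sum>p. prime_power_weight \<kappa> (p + Y))"
proof (cases "N = 0")
  case True
  have "0 \<le> (\<Sum>p. prime_power_weight \<kappa> (p + Y))"
    by (intro suminf_nonneg summable_ignore_initial_segment summable_weight weight_nonneg)
  then show ?thesis using True by simp
next
  case False
  define D where "D = {p \<in> {Y..<Y + Suc N}. prime p}"
  define U where "U = (\<Union>p\<in>D. {n. p ^ \<kappa> dvd n} \<inter> {1..N})"
  define A where "A = {n \<in> {n. prime_count J n = m}. 1 \<le> n \<and> n \<le> N}"
  define B where "B = {n \<in> {n. prime_count_below J Y n = m}. 1 \<le> n \<and> n \<le> N}"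
  have fin: "finite D" "finite U" "finite A" "finite B" by (auto simp: D_def U_def A_def B_def)
  have same: "prime_count J n = prime_count_below J Y n" if n: "1 \<le> n" "n \<le> N" "n \<notin> U" for n
  proof -
    have "p < Y" if "prime p" "multiplicity p n \<in> J" for p
    proof (rule ccontr)
      assume "\<not> p < Y"
      have "p ^ \<kappa> dvd n" using least[OF that(2)] by (rule multiplicity_dvd')
      moreover have "p \<le> n"
      proof -
        have "p dvd p ^ \<kappa>" using pos by simp
        then have "p dvd n" using \<open>p ^ \<kappa> dvd n\<close> by (rule dvd_trans)
        then show ?thesis using n by (intro dvd_imp_le) auto
      qed
      ultimately show False using \<open>\<not> p < Y\<close> that n by (auto simp: U_def D_def)
    qed
    then show ?thesis unfolding prime_count_def prime_count_below_def
      by (intro arg_cong[where f = card]) auto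
  qed
  have "A \<subseteq> B \<union> U" "B \<subseteq> A \<union> U" using same by (auto simp: A_def B_def)
  then have "card A \<le> card B + card U" "card B \<le> card A + card U"
    using fin by (meson card_Un_le card_mono finite_UnI order_trans)+
  then have "\<bar>real (card A) - real (card B)\<bar> \<le> real (card U)" by linarith
  also have "\<dots> \<le> (\<Sum>p\<in>D. real N * prime_power_weight \<kappa> p)"
  proof -
    have "card U \<le> (\<Sum>p\<in>D. card ({n. p ^ \<kappa> dvd n} \<inter> {1..N}))"
      unfolding U_def by (rule card_UN_le[OF fin(1)])
    also have "\<dots> = (\<Sum>p\<in>D. N div p ^ \<kappa>)"
    proof (rule sum.cong[OF refl])
      fix p assume "p \<in> D"
      then have "p > 0" by (auto simp: D_def dest: prime_gt_0_nat)
      have "card ({n. p ^ \<kappa> dvd n} \<inter> {1..N}) = count_upto {n \<in> UNIV. p ^ \<kappa> dvd n} N"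
        unfolding count_upto_def by (rule arg_cong[where f = card]) auto
      also have "\<dots> = count_upto UNIV (N div p ^ \<kappa>)"
        using \<open>p > 0\<close> by (intro count_upto_dvd) auto
      also have "{n. 1 \<le> n \<and> n \<le> N div p ^ \<kappa>} = {1..N div p ^ \<kappa>}" by auto
      then have "count_upto UNIV (N div p ^ \<kappa>) = N div p ^ \<kappa>" by (simp add: count_upto_def)
      finally show "card ({n. p ^ \<kappa> dvd n} \<inter> {1..N}) = N div p ^ \<kappa>" .
    qed
    finally have "real (card U) \<le> (\<Sum>p\<in>D. real (N div p ^ \<kappa>))"
      by (metis of_nat_mono of_nat_sum)
    also have "\<dots> \<le> (\<Sum>p\<in>D. real N * prime_power_weight \<kappa> p)"
    proof (rule sum_mono)
      fix p assume "p \<in> D"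
      then show "real (N div p ^ \<kappa>) \<le> real N * prime_power_weight \<kappa> p"
        using of_nat_div_le_of_nat[of N "p ^ \<kappa>", where 'a = real]
        by (simp add: D_def prime_power_weight_def)
    qed
    finally show ?thesis .
  qed
  also have "\<dots> \<le> real N * (\<Sum>p. prime_power_weight \<kappa> (p + Y))"
  proof -
    have "(\<Sum>p\<in>D. prime_power_weight \<kappa> p) \<le> (\<Sum>p\<in>{Y..<Y + Suc N}. prime_power_weight \<kappa> p)"
      by (intro sum_mono2) (auto simp: D_def weight_nonneg)
    also have "\<dots> = (\<Sum>p<Suc N. prime_power_weight \<kappa> (p + Y))"
      using sum.shift_bounds_nat_ivl[of "prime_power_weight \<kappa>" 0 Y "Suc N"]
      by (simp add: atLeast0LessThan add.commute)
    also have "\<dots> \<le> (\<Sum>p. prime_power_weight \<kappa> (p + Y))"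
      by (intro sum_le_suminf summable_ignore_initial_segment summable_weight) (auto simp: weight_nonneg)
    finally show ?thesis by (simp add: sum_distrib_left[symmetric] mult_left_mono)
  qed
  finally have "\<bar>real (card A) - real (card B)\<bar> / real N \<le> (\<Sum>p. prime_power_weight \<kappa> (p + Y))"
    using False by (simp add: divide_le_eq mult.commute)
  then show ?thesis
    by (simp add: A_def B_def count_upto_def abs_div_pos diff_divide_distrib[symmetric] False)
qed

definition E :: "nat \<Rightarrow> real" where
  "E m = natural_density {n. n \<ge> 1 \<and> prime_count J n = m}"

lemma density_exists:
  "seq_density {n. prime_count J n = m} (E m)" "(\<lambda>Y. poisson_binomial c Y m) \<longlonglongrightarrow> E m"
proof -
  let ?A = "{n. prime_count J n = m}"
  obtain l where l: "(\<lambda>N. real (count_upto ?A N) / real N) \<longlonglongrightarrow> l" "(\<lambda>Y. poisson_binomial c Y m) \<longlonglongrightarrow> l"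
  proof (rule limits_interchange)
    show "\<bar>real (count_upto ?A N) / real N
       - real (count_upto {n. prime_count_below J Y n = m} N) / real N\<bar>
        \<le> (\<Sum>p. prime_power_weight \<kappa> (p + Y))" for Y N
      by (rule count_differ)
    show "(\<lambda>N. real (count_upto {n. prime_count_below J Y n = m} N) / real N) \<longlonglongrightarrow> poisson_binomial c Y m" for Y
      using density_prime_count_below[of J Y m] by (simp add: seq_density_def)
    have "(\<lambda>Y. (\<Sum>p. prime_power_weight \<kappa> p) - (\<Sum>p<Y. prime_power_weight \<kappa> p))
        \<longlonglongrightarrow> (\<Sum>p. prime_power_weight \<kappa> p) - (\<Sum>p. prime_power_weight \<kappa> p)"
      by (intro tendsto_diff tendsto_const summable_LIMSEQ summable_weight)
    then show "(\<lambda>Y. \<Sum>p. prime_power_weight \<kappa> (p + Y)) \<longlonglongrightarrow> 0"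
      by (simp add: suminf_minus_initial_segment[OF summable_weight])
  qed (rule that)
  have "seq_density {n. n \<ge> 1 \<and> prime_count J n = m} l"
    using l(1) by (subst seq_density_cong[of _ ?A]) (auto simp: seq_density_def)
  then have "E m = l"
    unfolding E_def by (intro natural_density_eq seq_density_imp_natural)
  with l show "seq_density ?A (E m)" "(\<lambda>Y. poisson_binomial c Y m) \<longlonglongrightarrow> E m"
    by (auto simp: seq_density_def)
qed

lemma has_density: "has_natural_density {n. n \<ge> 1 \<and> prime_count J n = m} (E m)"
proof (rule seq_density_imp_natural)
  show "seq_density {n. n \<ge> 1 \<and> prime_count J n = m} (E m)"
    using density_exists(1)[of m] by (subst seq_density_cong[of _ "{n. prime_count J n = m}"]) auto
qed

lemma E_nonneg: "0 \<le> E m"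
  by (rule seq_density_nonneg[OF density_exists(1)])

text \<open>
  One nonnegative term of a power series is at most its sum at \<open>R\<close>. As \<open>R\<close> is arbitrary, this
  dominates the coefficients, uniformly in \<open>Y\<close>, by any geometric sequence.
\<close>
lemma poisson_binomial_le:
  assumes "R \<ge> 1"
  shows "poisson_binomial c Y m * R ^ m \<le> exp (R * suminf c)"
proof -
  have "(\<lambda>m. poisson_binomial c Y m * R ^ m) sums (\<Prod>p<Y. 1 + c p * (R - 1))"
    using poisson_binomial_sums[of c Y R] by simp
  moreover have "0 \<le> poisson_binomial c Y m * R ^ m" for m
    using assms by (intro mult_nonneg_nonneg poisson_binomial_nonneg density_nonneg density_le_1) auto
  ultimately have "poisson_binomial c Y m * R ^ m \<le> (\<Prod>p<Y. 1 + c p * (R - 1))"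
    using sum_le_suminf[of "\<lambda>m. poisson_binomial c Y m * R ^ m" "{m}"] by (simp add: sums_iff)
  also have "\<dots> \<le> (\<Prod>p<Y. exp (R * c p))"
  proof (rule prod_mono)
    fix p
    have "1 + c p * (R - 1) \<le> 1 + R * c p" using density_nonneg[of p] by (simp add: algebra_simps)
    also have "\<dots> \<le> exp (R * c p)" by (rule exp_ge_add_one_self)
    finally show "0 \<le> 1 + c p * (R - 1) \<and> 1 + c p * (R - 1) \<le> exp (R * c p)"
      using assms density_nonneg[of p] by auto
  qed
  also have "\<dots> = exp (R * (\<Sum>p<Y. c p))" by (simp add: exp_sum sum_distrib_left)
  also have "\<dots> \<le> exp (R * suminf c)"
    using assms by (auto intro!: mult_left_mono sum_le_suminf summable_density density_nonneg)
  finally show ?thesis .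
qed

lemma generating_function:
  fixes z :: "'a :: {real_normed_field, banach}"
  defines "S \<equiv> (\<Sum>m. of_real (E m) * z ^ m)"
  shows "(\<lambda>m. of_real (E m) * z ^ m) sums S"
    and "(\<lambda>Y. \<Prod>p<Y. 1 + of_real (c p) * (z - 1)) \<longlonglongrightarrow> S"
proof -
  \<comment> \<open>With this radius the terms at \<open>z\<close> are dominated by a geometric series of ratio \<open>1 / 2\<close>.\<close>
  define R where "R = 2 * norm z + 1"
  have R: "R \<ge> 1" "R > 0" by (auto simp: R_def add_nonneg_pos)
  define K where "K = exp (R * suminf c)"
  have bound: "norm (of_real (poisson_binomial c Y m) * z ^ m) \<le> K * (1 / 2) ^ m" for Y m
  proof -
    have nn: "0 \<le> poisson_binomial c Y m"
      by (intro poisson_binomial_nonneg density_nonneg density_le_1)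
    have "norm (of_real (poisson_binomial c Y m) * z ^ m) = poisson_binomial c Y m * norm z ^ m"
      using nn by (simp add: norm_mult norm_power)
    also have "\<dots> \<le> poisson_binomial c Y m * (R / 2) ^ m"
      using nn by (intro mult_left_mono power_mono) (auto simp: R_def)
    also have "\<dots> = poisson_binomial c Y m * R ^ m * (1 / 2) ^ m"
      by (simp add: power_divide)
    also have "\<dots> \<le> K * (1 / 2) ^ m"
      unfolding K_def by (intro mult_right_mono poisson_binomial_le R) auto
    finally show ?thesis .
  qed
  have "summable (\<lambda>m. norm (of_real (E m) * z ^ m)) \<and>
      (\<lambda>Y. \<Sum>m. of_real (poisson_binomial c Y m) * z ^ m) \<longlonglongrightarrow> S"
    unfolding S_def
  proof (rule tannerys_theorem[THEN conjunct2])
    show "(\<lambda>Y. of_real (poisson_binomial c Y m) * z ^ m) \<longlonglongrightarrow> of_real (E m) * z ^ m" for m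
      by (intro tendsto_intros tendsto_of_real density_exists(2))
    show "\<forall>\<^sub>F (m, Y) in at_top \<times>\<^sub>F sequentially. norm (of_real (poisson_binomial c Y m) * z ^ m) \<le> K * (1 / 2) ^ m"
      using bound by (intro always_eventually) auto
    show "summable (\<lambda>m. K * (1 / 2) ^ m)" by (intro summable_mult summable_geometric) auto
  qed simp
  then show "(\<lambda>m. of_real (E m) * z ^ m) sums S"
    and "(\<lambda>Y. \<Prod>p<Y. 1 + of_real (c p) * (z - 1)) \<longlonglongrightarrow> S"
    using poisson_binomial_sums[of c _ z] unfolding S_def
    by (auto simp: sums_iff dest: summable_norm_cancel)
qed

lemma has_prime_prod_generating_function:
  "has_prime_prod (\<lambda>p. 1 + of_real (c p) * (z - 1)) (\<Sum>m. of_real (E m) * z ^ m)"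
proof -
  let ?f = "\<lambda>p. 1 + of_real (c p) * (z - 1)"
  have eq: "(\<lambda>p. if prime p then ?f p else 1) = ?f" by (auto simp: prime_density_def)
  have "summable (\<lambda>p. norm (?f p - 1))"
    using summable_mult2[OF summable_density, of "norm (z - 1)"]
    by (simp add: norm_mult density_nonneg)
  then have conv: "?f has_prod prodinf ?f"
    by (intro convergent_prod_has_prod abs_convergent_prod_imp_convergent_prod summable_imp_abs_convergent_prod)
  have "(\<lambda>Y. \<Prod>p<Y. ?f p) \<longlonglongrightarrow> prodinf ?f" using has_prod_imp_tendsto'[OF conv] .
  with generating_function(2)[of z] have "prodinf ?f = (\<Sum>m. of_real (E m) * z ^ m)"
    using LIMSEQ_unique by blast
  with conv show ?thesis by (simp add: has_prime_prod_def eq)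
qed

lemma entire: "(\<lambda>z::complex. \<Sum>m. of_real (E m) * z ^ m) holomorphic_on UNIV"
proof -
  have "((\<lambda>z::complex. \<Sum>m. of_real (E m) * z ^ m) has_field_derivative
      (\<Sum>m. diffs (\<lambda>m. of_real (E m)) m * z ^ m)) (at z)" for z
    by (rule termdiffs_strong_converges_everywhere) (use generating_function(1) in \<open>auto simp: sums_iff\<close>)
  then show ?thesis by (auto simp: holomorphic_on_open)
qed

end

section \<open>Divergence of the sum of the reciprocals of the primes\<close>

text \<open>
  Otherwise \<open>{1..}\<close> would be an admissible set of exponents, and the generating function at \<open>0\<close> would
  say that the set \<open>{1}\<close> of integers without prime factors, which has density \<open>0\<close>, has density
  \<open>\<Prod>p. 1 - 1 / p\<close>. A product in the sense of \<open>has_prod\<close> vanishes only if one of its factors does.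
\<close>
theorem not_summable_prime_reciprocals: "\<not> summable (prime_power_weight 1)"
proof
  assume "summable (prime_power_weight 1)"
  then interpret exponent_set "{1..}" 1 by unfold_locales auto
  have one: "n = 1" if "n \<ge> 1" "prime_count {1..} n = 0" for n
  proof (rule ccontr)
    assume "n \<noteq> 1"
    then obtain p where p: "prime p" "p dvd n" using prime_factor_nat by blast
    have "{p. prime p \<and> multiplicity p n \<in> {1..}} \<subseteq> {..n}"
    proof
      fix q assume "q \<in> {p. prime p \<and> multiplicity p n \<in> {1..}}"
      then have "q dvd n" using not_dvd_imp_multiplicity_0[of q n] by fastforce
      then show "q \<in> {..n}" using \<open>n \<ge> 1\<close> by (auto dest: dvd_imp_le)
    qed
    then have "finite {p. prime p \<and> multiplicity p n \<in> {1..}}" by (rule finite_subset) simp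
    moreover have "multiplicity p n \<ge> 1"
      using p that(1) by (intro multiplicity_geI) (auto simp: not_prime_unit)
    ultimately show False using p that(2) by (auto simp: prime_count_def)
  qed
  have "(\<lambda>N. real (count_upto {n. prime_count {1..} n = 0} N) / real N) \<longlonglongrightarrow> 0"
  proof (rule Lim_null_comparison[OF _ lim_1_over_n], intro always_eventually allI)
    fix N
    have "count_upto {n. prime_count {1..} n = 0} N \<le> card {1::nat}"
      unfolding count_upto_def by (rule card_mono) (use one in auto)
    then show "norm (real (count_upto {n. prime_count {1..} n = 0} N) / real N) \<le> 1 / real N"
      by (auto intro!: divide_right_mono)
  qed
  with density_exists(1)[of 0] have "E 0 = 0"
    unfolding seq_density_def by (rule LIMSEQ_unique)
  have "has_prime_prod (\<lambda>p. 1 + of_real (c p) * (0 - 1)) (\<Sum>m. of_real (E m) * 0 ^ m)"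
    by (rule has_prime_prod_generating_function)
  moreover have "(\<Sum>m. of_real (E m) * 0 ^ m) = (0 :: complex)"
    using \<open>E 0 = 0\<close> by (subst powser_zero) simp
  ultimately have "(\<lambda>p. if prime p then 1 + of_real (c p) * (0 - 1) else 1 :: complex) has_prod 0"
    unfolding has_prime_prod_def by (simp only:)
  then obtain p where "(if prime p then 1 + of_real (c p) * (0 - 1) else 1 :: complex) = 0"
    unfolding has_prod_0_iff by blast
  then have p: "prime p" "of_real (c p) = (1 :: complex)" by (auto split: if_splits)
  have "c p \<le> 1 / real p" using density_le[of p] p(1) by (simp add: prime_power_weight_def)
  also have "\<dots> < 1" using prime_gt_1_nat[OF p(1)] by simp
  finally show False using p(2) by simp
qed

section \<open>The upper bound\<close>

text \<open>
  Replaces \<open>1 + x \<le> exp x\<close> where \<open>x\<close> may be large: a smaller power of \<open>x\<close> in the exponent gives a better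
  bound for the product, as long as \<open>\<Sum> p powr (- \<kappa> * \<theta>)\<close> converges.
\<close>
lemma one_plus_le_exp_powr:
  fixes x \<theta> :: real
  assumes "x \<ge> 0" "0 < \<theta>" "\<theta> \<le> 1"
  shows "1 + x \<le> exp (x powr \<theta> / \<theta>)"
proof (cases "x \<le> 1")
  case True
  have "x \<le> x powr \<theta>" using assms True powr_mono'[of \<theta> 1 x] by (cases "x = 0") auto
  also have "\<dots> \<le> x powr \<theta> / \<theta>" using assms mult_left_le[of \<theta> "x powr \<theta>"] by (simp add: le_divide_eq)
  finally have "exp x \<le> exp (x powr \<theta> / \<theta>)" by simp
  then show ?thesis using exp_ge_add_one_self[of x] by linarith
next
  case False
  have "ln (1 + x) \<le> ln (2 * x)" using False by simp
  also have "\<dots> = ln 2 + ln x" using False by (simp add: ln_mult)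
  also have "ln 2 \<le> (1::real)" using ln_le_minus_one[of "2::real"] by simp
  also have "\<theta> * ln x \<le> x powr \<theta> - 1"
    using ln_le_minus_one[of "x powr \<theta>"] False by (simp add: ln_powr)
  then have "ln x \<le> (x powr \<theta> - 1) / \<theta>" using assms by (simp add: le_divide_eq mult.commute)
  then have "1 + ln x \<le> x powr \<theta> / \<theta> + (1 - 1 / \<theta>)" by (simp add: diff_divide_distrib)
  also have "1 - 1 / \<theta> \<le> 0" using assms by (simp add: le_divide_eq)
  finally have "ln (1 + x) \<le> x powr \<theta> / \<theta>" by simp
  then show ?thesis using False ln_ge_iff[of "1 + x"] 
    by (metis exp_le_cancel_iff exp_ln add_pos_pos less_trans not_le zero_less_one)
qed

context exponent_set
begin

abbreviation G :: "real \<Rightarrow> real" where "G R \<equiv> (\<Sum>m. E m * R ^ m)"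

lemma G_sums: "(\<lambda>m. E m * R ^ m) sums G R"
  using generating_function(1)[of R] by simp

lemma G_lim: "(\<lambda>Y. \<Prod>p<Y. 1 + c p * (R - 1)) \<longlonglongrightarrow> G R"
  using generating_function(2)[of R] by simp

lemma G_growth:
  assumes \<theta>: "0 < \<theta>" "\<theta> \<le> 1" "real \<kappa> * \<theta> > 1"
  obtains C where "\<And>R. R \<ge> 1 \<Longrightarrow> G R \<le> exp (C * R powr \<theta>)"
proof -
  define g where "g p = real p powr - (real \<kappa> * \<theta>)" for p :: nat
  have g: "summable g" unfolding g_def using \<theta> by (subst summable_real_powr_iff) auto
  have g_nonneg: "g p \<ge> 0" for p by (simp add: g_def)
  have "G R \<le> exp (suminf g / \<theta> * R powr \<theta>)" if R: "R \<ge> 1" for R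
  proof (rule tendsto_upperbound[OF G_lim])
    have "(\<Prod>p<Y. 1 + c p * (R - 1)) \<le> exp (suminf g / \<theta> * R powr \<theta>)" for Y
    proof -
      have "(\<Prod>p<Y. 1 + c p * (R - 1)) \<le> (\<Prod>p<Y. exp (g p * R powr \<theta> / \<theta>))"
      proof (rule prod_mono)
        fix p
        have "c p * (R - 1) \<le> c p * R" using density_nonneg by (intro mult_left_mono) auto
        then have "1 + c p * (R - 1) \<le> 1 + c p * R" by simp
        also have "\<dots> \<le> exp ((c p * R) powr \<theta> / \<theta>)"
          using density_nonneg R \<theta> by (intro one_plus_le_exp_powr) auto
        also have "\<dots> \<le> exp (g p * R powr \<theta> / \<theta>)"
        proof -
          have "c p powr \<theta> \<le> prime_power_weight \<kappa> p powr \<theta>"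
            using density_nonneg density_le \<theta> by (intro powr_mono2) auto
          also have "\<dots> \<le> g p"
          proof (cases "prime p")
            case True
            then have "p > 0" by (rule prime_gt_0_nat)
            then have "prime_power_weight \<kappa> p = real p powr - real \<kappa>"
              using True by (simp add: prime_power_weight_def powr_minus powr_realpow divide_inverse)
            then show ?thesis by (simp add: g_def powr_powr)
          qed (simp add: prime_power_weight_def g_def)
          finally have "c p powr \<theta> \<le> g p" .
          then show ?thesis using density_nonneg R \<theta>
            by (auto simp: powr_mult intro!: divide_right_mono mult_right_mono)
        qed
        finally show "0 \<le> 1 + c p * (R - 1) \<and> 1 + c p * (R - 1) \<le> exp (g p * R powr \<theta> / \<theta>)"
          using density_nonneg[of p] R by auto
      qed
      also have "\<dots> = exp ((\<Sum>p<Y. g p) * R powr \<theta> / \<theta>)"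
        by (simp add: exp_sum sum_distrib_right sum_divide_distrib)
      also have "\<dots> \<le> exp (suminf g * R powr \<theta> / \<theta>)"
        using \<theta> by (auto intro!: divide_right_mono mult_right_mono sum_le_suminf g g_nonneg)
      finally show ?thesis by simp
    qed
    then show "\<forall>\<^sub>F Y in sequentially. (\<Prod>p<Y. 1 + c p * (R - 1)) \<le> exp (suminf g / \<theta> * R powr \<theta>)"
      by (intro always_eventually allI)
  qed simp
  then show thesis by (rule that)
qed

text \<open>
  The choice \<open>R = m powr b\<close> in \<open>E m * R ^ m \<le> G R \<le> exp (C * R powr (1 / b))\<close>, with \<open>b\<close> slightly below
  \<open>\<kappa>\<close>, makes the exponent on the right \<open>C * m\<close>, which is negligible against \<open>m * ln m\<close>.
\<close>
lemma eventually_E_le: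
  assumes "\<kappa> \<ge> 2" "\<eta> > 0"
  shows "\<forall>\<^sub>F m in sequentially. E m \<le> real m powr (- (real \<kappa> - \<eta>) * real m)"
proof -
  \<comment> \<open>The minimum with \<open>1\<close> keeps the exponent \<open>b\<close> above \<open>1\<close>; half of \<open>\<eta>\<close> is left to absorb \<open>exp (C * m)\<close>.\<close>
  define h where "h = min \<eta> 1 / 2"
  have h: "0 < h" "2 * h \<le> \<eta>" "h \<le> 1 / 2" using assms(2) by (auto simp: h_def)
  define b where "b = real \<kappa> - h"
  have b: "b > 1" "b < real \<kappa>" using assms(1) h by (auto simp: b_def)
  obtain C where C: "\<And>R. R \<ge> 1 \<Longrightarrow> G R \<le> exp (C * R powr (1 / b))"
    using G_growth[of "1 / b"] b by auto
  have "\<forall>\<^sub>F m in sequentially. C \<le> h * ln (real m)"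
    using h(1) by real_asymp
  then show ?thesis using eventually_ge_at_top[of 1]
  proof eventually_elim
    case (elim m)
    define R where "R = real m powr b"
    have R: "R \<ge> 1" using elim(2) b by (simp add: R_def ge_one_powr_ge_zero)
    have "R powr (1 / b) = real m" using b elim(2) by (simp add: R_def powr_powr)
    then have "G R \<le> exp (C * real m)" using C[OF R] by simp
    moreover have "E m * R ^ m \<le> G R"
      using sum_le_suminf[of "\<lambda>m. E m * R ^ m" "{m}"] G_sums[of R] E_nonneg R
      by (simp add: sums_iff)
    moreover have "exp (C * real m) \<le> exp (h * ln (real m) * real m)"
      using elim(1) by (auto intro: mult_right_mono)
    moreover have "exp (h * ln (real m) * real m) = real m powr (h * real m)"
      using elim(2) by (simp add: powr_def mult_ac)
    moreover have "R ^ m = real m powr (b * real m)"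
      using elim(2) R by (simp add: R_def powr_powr flip: powr_realpow)
    ultimately have "E m * real m powr (b * real m) \<le> real m powr (h * real m)" by simp
    then have "E m \<le> real m powr (h * real m) / real m powr (b * real m)"
      using elim(2) by (simp add: le_divide_eq)
    also have "\<dots> = real m powr ((h - b) * real m)" by (simp add: powr_diff left_diff_distrib)
    also have "\<dots> \<le> real m powr (- (real \<kappa> - \<eta>) * real m)"
      using elim(2) h by (intro powr_mono mult_right_mono) (auto simp: b_def)
    finally show ?case .
  qed
qed

lemma E_upper_bound:
  assumes "\<kappa> \<ge> 2"
  shows "\<exists>\<delta>::nat \<Rightarrow> real. \<delta> \<longlonglongrightarrow> 0 \<and>
    (\<forall>\<^sub>F m in sequentially. E m \<le> real m powr (- (real \<kappa> - \<delta> m) * real m))"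
proof (intro exI conjI)
  \<comment> \<open>For \<open>m \<ge> 2\<close> this is the least nonnegative \<open>\<delta> m\<close> for which the bound holds; when \<open>E m = 0\<close> every value will do.\<close>
  define \<delta> where "\<delta> m = (if E m = 0 then 0 else max 0 (real \<kappa> + ln (E m) / (real m * ln (real m))))" for m
  show "\<delta> \<longlonglongrightarrow> 0"
  proof (rule LIMSEQ_I)
    fix r :: real assume "r > 0"
    have "\<forall>\<^sub>F m in sequentially. norm (\<delta> m - 0) < r"
      using eventually_E_le[OF assms half_gt_zero[OF \<open>r > 0\<close>]] eventually_ge_at_top[of 2]
    proof eventually_elim
      case (elim m)
      show ?case
      proof (cases "E m = 0")
        case False
        then have "E m > 0" using E_nonneg[of m] by simp
        then have "ln (E m) \<le> ln (real m powr (- (real \<kappa> - r / 2) * real m))"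
          using elim by (intro iffD2[OF ln_le_cancel_iff]) auto
        also have "\<dots> = (r / 2 - real \<kappa>) * (real m * ln (real m))"
          using elim(2) by (simp add: ln_powr)
        finally have "ln (E m) / (real m * ln (real m)) \<le> r / 2 - real \<kappa>"
          using elim(2) by (simp add: divide_le_eq)
        then show ?thesis using False \<open>r > 0\<close> by (auto simp: \<delta>_def)
      qed (use \<open>r > 0\<close> in \<open>simp add: \<delta>_def\<close>)
    qed
    then show "\<exists>M. \<forall>m\<ge>M. norm (\<delta> m - 0) < r" by (simp add: eventually_sequentially)
  qed
  show "\<forall>\<^sub>F m in sequentially. E m \<le> real m powr (- (real \<kappa> - \<delta> m) * real m)"
    using eventually_ge_at_top[of 2]
  proof eventually_elim
    case (elim m)
    show ?case
    proof (cases "E m = 0")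
      case False
      then have pos: "E m > 0" using E_nonneg[of m] by simp
      have "ln (E m) / (real m * ln (real m)) \<le> - (real \<kappa> - \<delta> m)"
        using False by (auto simp: \<delta>_def)
      then have "ln (E m) \<le> - (real \<kappa> - \<delta> m) * (real m * ln (real m))"
        using elim by (simp add: divide_le_eq)
      also have "\<dots> = ln (real m powr (- (real \<kappa> - \<delta> m) * real m))"
        using elim by (simp add: ln_powr)
      finally show ?thesis using pos elim by (subst (asm) ln_le_cancel_iff) auto
    qed simp
  qed
qed

end

section \<open>The lower bound\<close>

definition prime_pi :: "nat \<Rightarrow> nat" where
  "prime_pi y = card {p. p \<le> y \<and> prime p}"

lemma finite_le [simp]: "finite {p. p \<le> (y::nat) \<and> Q p}"
  by (rule finite_subset[of _ "{..y}"]) auto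

lemma prime_pi_less:
  assumes "prime q" "p < q"
  shows "prime_pi p < prime_pi q"
  unfolding prime_pi_def
proof (rule psubset_card_mono)
  have "q \<notin> {r. r \<le> p \<and> prime r}" "q \<in> {r. r \<le> q \<and> prime r}" using assms by auto
  moreover have "{r. r \<le> p \<and> prime r} \<subseteq> {r. r \<le> q \<and> prime r}" using assms by auto
  ultimately show "{r. r \<le> p \<and> prime r} \<subset> {r. r \<le> q \<and> prime r}" by blast
qed simp

text \<open>
  If \<open>\<pi>(p) \<le> p powr \<alpha>\<close>, then \<open>1 / p \<le> \<pi>(p) powr (- 1 / \<alpha>)\<close>. Since \<open>\<pi>\<close> is injective on the primes, the sum
  of \<open>1 / p\<close> would be dominated by \<open>\<Sum>k. k powr (- 1 / \<alpha>)\<close>, which converges.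
\<close>
lemma prime_pi_not_eventually_small:
  assumes "0 < \<alpha>" "\<alpha> < 1"
  shows "\<not> (\<forall>\<^sub>F y in sequentially. real (prime_pi y) \<le> real y powr \<alpha>)"
proof
  assume "\<forall>\<^sub>F y in sequentially. real (prime_pi y) \<le> real y powr \<alpha>"
  then obtain Y where Y: "\<And>y. y \<ge> Y \<Longrightarrow> real (prime_pi y) \<le> real y powr \<alpha>"
    by (auto simp: eventually_sequentially)
  define g where "g k = real k powr - (1 / \<alpha>)" for k :: nat
  have g: "summable g" unfolding g_def using assms by (subst summable_real_powr_iff) auto
  have g_nonneg: "g k \<ge> 0" for k by (simp add: g_def)
  define w where "w p = (if p \<ge> Y then prime_power_weight 1 p else 0)" for p
  have "summable w"
  proof (rule summableI_nonneg_bounded)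
    show "0 \<le> w p" for p by (simp add: w_def prime_power_weight_def)
    fix n
    define P where "P = {p. p < n \<and> prime p \<and> p \<ge> Y}"
    have "(\<Sum>p<n. w p) = (\<Sum>p\<in>P. 1 / real p)"
      by (rule sum.mono_neutral_cong_right) (auto simp: P_def w_def prime_power_weight_def)
    also have "\<dots> \<le> (\<Sum>p\<in>P. g (prime_pi p))"
    proof (rule sum_mono)
      fix p assume "p \<in> P"
      then have p: "prime p" "p \<ge> Y" by (auto simp: P_def)
      have pi: "prime_pi p > 0" using prime_pi_less[OF p(1), of 0] prime_gt_0_nat[OF p(1)] by simp
      have "real (prime_pi p) powr (1 / \<alpha>) \<le> (real p powr \<alpha>) powr (1 / \<alpha>)"
        using assms Y[OF p(2)] by (intro powr_mono2) auto
      also have "\<dots> = real p" using assms by (simp add: powr_powr)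
      finally have "1 / real p \<le> 1 / real (prime_pi p) powr (1 / \<alpha>)"
        using pi by (intro divide_left_mono mult_pos_pos) (auto simp: prime_gt_0_nat p(1))
      then show "1 / real p \<le> g (prime_pi p)" by (simp add: g_def powr_minus divide_inverse)
    qed
    also have "\<dots> = sum g (prime_pi ` P)"
    proof (rule sum.reindex_cong[symmetric, OF _ refl refl])
      show "inj_on prime_pi P"
        by (rule linorder_inj_onI) (auto simp: P_def dest: prime_pi_less)
    qed
    also have "\<dots> \<le> suminf g"
      by (rule sum_le_suminf) (auto simp: P_def g g_nonneg)
    finally show "(\<Sum>p<n. w p) \<le> suminf g" .
  qed
  moreover have "\<forall>\<^sub>F p in sequentially. w p = prime_power_weight 1 p"
    using eventually_ge_at_top[of Y] by eventually_elim (simp add: w_def)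
  ultimately show False using not_summable_prime_reciprocals by (simp add: summable_cong)
qed

lemma log_power_product_small:
  fixes a d k K :: real
  assumes "0 < a" "0 < d"
  shows "\<forall>\<^sub>F y::nat in sequentially.
     ln 3 + (K + 6 * real y powr a) * (ln 3 + k * ln (real y)) \<le> ln 2 * real y powr (a + d)"
proof -
  have 1: "(\<lambda>y::nat. ln 3 / real y powr (a + d)) \<longlonglongrightarrow> 0" using assms by real_asymp
  have 2: "(\<lambda>y::nat. ln 3 / real y powr d) \<longlonglongrightarrow> 0" using assms by real_asymp
  have 3: "(\<lambda>y::nat. ln (real y) / real y powr d) \<longlonglongrightarrow> 0" using assms by real_asymp
  have 4: "(\<lambda>y::nat. K / real y powr a) \<longlonglongrightarrow> 0" using assms by real_asymp
  have "(\<lambda>y::nat. ln 3 / real y powr (a + d) +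
     (K / real y powr a + 6) * (ln 3 / real y powr d + k * (ln (real y) / real y powr d)))
     \<longlonglongrightarrow> 0 + (0 + 6) * (0 + k * 0)"
    by (intro tendsto_intros 1 2 3 4)
  then have "\<forall>\<^sub>F y::nat in sequentially. ln 3 / real y powr (a + d) +
     (K / real y powr a + 6) * (ln 3 / real y powr d + k * (ln (real y) / real y powr d)) < ln 2"
    by (rule order_tendstoD) simp
  then show ?thesis using eventually_gt_at_top[of 0]
  proof eventually_elim
    case (elim y)
    have "ln 3 / real y powr (a + d) +
       (K / real y powr a + 6) * (ln 3 / real y powr d + k * (ln (real y) / real y powr d))
       = (ln 3 + (K + 6 * real y powr a) * (ln 3 + k * ln (real y))) / real y powr (a + d)"
      using elim(2) by (simp add: powr_add field_simps)
    with elim show ?case by (simp add: divide_less_eq)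
  qed
qed

context exponent_set
begin

text \<open>
  At this argument every factor of the product with \<open>p \<le> y\<close> is at least \<open>2\<close>, and the others are at
  least \<open>1\<close>.
\<close>
lemma two_power_prime_pi_le: "2 ^ prime_pi y \<le> G (1 + 2 * real y ^ \<kappa>)"
proof (rule tendsto_lowerbound[OF G_lim])
  have "2 ^ prime_pi y \<le> (\<Prod>p<Y. 1 + c p * (1 + 2 * real y ^ \<kappa> - 1))" if "Y > y" for Y
  proof -
    have ge: "1 \<le> 1 + c p * (1 + 2 * real y ^ \<kappa> - 1)" for p using density_nonneg by simp
    have "(2::real) ^ prime_pi y = (\<Prod>p | p \<le> y \<and> prime p. 2)" by (simp add: prime_pi_def)
    also have "\<dots> \<le> (\<Prod>p | p \<le> y \<and> prime p. 1 + c p * (1 + 2 * real y ^ \<kappa> - 1))"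
    proof (rule prod_mono)
      fix p assume "p \<in> {p. p \<le> y \<and> prime p}"
      then have p: "p \<le> y" "prime p" by auto
      have "1 \<le> real y ^ \<kappa> / real p ^ \<kappa>"
        using p prime_gt_0_nat[OF p(2)] by (simp add: power_mono)
      also have "\<dots> = 1 / (2 * real p ^ \<kappa>) * (2 * real y ^ \<kappa>)" by simp
      also have "\<dots> \<le> c p * (2 * real y ^ \<kappa>)"
        by (intro mult_right_mono density_ge p) simp
      finally show "0 \<le> (2::real) \<and> 2 \<le> 1 + c p * (1 + 2 * real y ^ \<kappa> - 1)" by simp
    qed
    also have "\<dots> \<le> (\<Prod>p<Y. 1 + c p * (1 + 2 * real y ^ \<kappa> - 1))"
    proof (rule prod_mono2)
      show "0 \<le> 1 + c p * (1 + 2 * real y ^ \<kappa> - 1)" for p using ge[of p] by linarith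
    qed (use that ge in auto)
    finally show ?thesis .
  qed
  then show "\<forall>\<^sub>F Y in sequentially. 2 ^ prime_pi y \<le> (\<Prod>p<Y. 1 + c p * (1 + 2 * real y ^ \<kappa> - 1))"
    by (rule eventually_mono[OF eventually_gt_at_top[of y]])
qed simp

lemma G_one: "G 1 = 1"
  using LIMSEQ_unique[OF G_lim[of 1]] by simp

text \<open>
  The terms with \<open>m < T\<close> sum to at most \<open>R ^ T\<close>, because the densities sum to \<open>1\<close>; those with \<open>m \<ge> T\<close>
  are at most \<open>2\<^sup>-\<^sup>m\<close>, because then \<open>m powr \<beta> \<ge> 2 * R\<close>.
\<close>
lemma G_le_if_E_small:
  assumes small: "\<And>m. m \<ge> M \<Longrightarrow> E m \<le> real m powr (- \<beta> * real m)"
    and "\<beta> > 0" "R \<ge> 1" "T \<ge> M" "T \<ge> 1" "(2 * R) powr (1 / \<beta>) \<le> real T"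
  shows "G R \<le> 3 * R ^ T"
proof -
  have termwise: "E m * R ^ m \<le> R ^ T * E m + (1 / 2) ^ m" for m
  proof (cases "m < T")
    case True
    then have "R ^ m \<le> R ^ T" using assms(3) by (intro power_increasing) auto
    then have "E m * R ^ m \<le> R ^ T * E m" using E_nonneg[of m] by (subst (2) mult.commute) (rule mult_left_mono)
    moreover have "0 \<le> (1 / 2 :: real) ^ m" by simp
    ultimately show ?thesis by linarith
  next
    case False
    have "2 * R = ((2 * R) powr (1 / \<beta>)) powr \<beta>" using assms by (simp add: powr_powr)
    also have "\<dots> \<le> real m powr \<beta>" using False assms by (intro powr_mono2) auto
    finally have R: "R * real m powr - \<beta> \<le> 1 / 2"
      using False assms by (simp add: powr_minus field_simps)
    have "E m * R ^ m \<le> real m powr (- \<beta> * real m) * R ^ m"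
      using False assms by (intro mult_right_mono small) auto
    also have "\<dots> = (R * real m powr - \<beta>) ^ m"
      using False assms by (simp add: power_mult_distrib mult.commute powr_powr flip: powr_realpow)
    also have "\<dots> \<le> (1 / 2) ^ m" using R assms by (intro power_mono) auto
    also have "\<dots> \<le> R ^ T * E m + (1 / 2) ^ m" using assms E_nonneg by simp
    finally show ?thesis .
  qed
  have "(\<lambda>m. R ^ T * E m) sums (R ^ T * 1)"
    using sums_mult[OF G_sums[of 1], of "R ^ T"] by (simp add: G_one[simplified])
  moreover have "(\<lambda>m. (1 / 2 :: real) ^ m) sums 2" using geometric_sums[of "1 / 2 :: real"] by simp
  ultimately have "(\<lambda>m. R ^ T * E m + (1 / 2) ^ m) sums (R ^ T * 1 + 2)" by (rule sums_add)
  from sums_le[OF termwise G_sums this] have "G R \<le> R ^ T + 2" by simp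
  also have "\<dots> \<le> 3 * R ^ T" using one_le_power[OF assms(3), of T] by simp
  finally show ?thesis .
qed

text \<open>
  If the inequality failed for all \<open>m \<ge> M\<close>, the two preceding estimates of \<open>G R\<close> at
  \<open>R = 1 + 2 * y ^ \<kappa>\<close>, with \<open>T\<close> of size \<open>y powr (\<kappa> / (\<kappa> + \<epsilon>))\<close>, would bound \<open>\<pi>(y)\<close> by
  \<open>y powr (a + d)\<close> with \<open>a + d < 1\<close>, where the factor \<open>y powr d\<close> absorbs the logarithm.
\<close>
lemma E_lower_bound:
  assumes "\<epsilon> > 0"
  shows "infinite {m. E m \<ge> real m powr (- (real \<kappa> + \<epsilon>) * real m)}"
proof
  define \<beta> where "\<beta> = real \<kappa> + \<epsilon>"
  define a where "a = real \<kappa> / \<beta>"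
  have \<beta>: "\<beta> > 1" using pos assms by (simp add: \<beta>_def)
  have a: "0 < a" "a < 1" using pos assms by (auto simp: a_def \<beta>_def)
  define d where "d = (1 - a) / 2"
  have d: "0 < d" "a + d < 1" using a by (auto simp: d_def field_simps)
  assume "finite {m. E m \<ge> real m powr (- (real \<kappa> + \<epsilon>) * real m)}"
  then obtain M where M: "\<And>m. E m \<ge> real m powr (- \<beta> * real m) \<Longrightarrow> m < M"
    unfolding finite_nat_set_iff_bounded \<beta>_def by auto
  have small: "E m \<le> real m powr (- \<beta> * real m)" if "m \<ge> M" for m
    using M[of m] that by linarith
  have "\<forall>\<^sub>F y in sequentially. real (prime_pi y) \<le> real y powr (a + d)"
    using log_power_product_small[OF a(1) d(1), of "real M + 1" "real \<kappa>"] eventually_ge_at_top[of 1]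
  proof eventually_elim
    case (elim y)
    define R where "R = 1 + 2 * real y ^ \<kappa>"
    define u where "u = (2 * R) powr (1 / \<beta>)"
    define T where "T = M + nat \<lceil>u\<rceil>"
    have y: "1 \<le> real y ^ \<kappa>" using elim(2) by simp
    have R: "1 \<le> R" "R \<le> 3 * real y ^ \<kappa>" using y by (auto simp: R_def)
    have "u > 0" using R by (simp add: u_def)
    then have T: "u \<le> real T" "T \<ge> 1" "T \<ge> M" "real T \<le> real M + 1 + u" unfolding T_def by linarith+
    have "u \<le> (6 * real y ^ \<kappa>) powr (1 / \<beta>)"
      unfolding u_def using R \<beta> by (intro powr_mono2) auto
    also have "\<dots> = 6 powr (1 / \<beta>) * real y powr a"
      using elim(2) by (simp add: powr_mult a_def powr_powr flip: powr_realpow)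
    also have "6 powr (1 / \<beta>) \<le> 6 powr (1::real)" using \<beta> by (intro powr_mono) auto
    finally have u: "u \<le> 6 * real y powr a" by (simp add: mult_right_mono)
    have "2 ^ prime_pi y \<le> G R" unfolding R_def by (rule two_power_prime_pi_le)
    also have "\<dots> \<le> 3 * R ^ T"
      using \<beta> R T by (intro G_le_if_E_small[of M \<beta>, OF small]) (auto simp: u_def)
    finally have "ln (2 ^ prime_pi y) \<le> ln (3 * R ^ T)" using R by (subst ln_le_cancel_iff) auto
    then have "real (prime_pi y) * ln 2 \<le> ln 3 + real T * ln R"
      using R by (simp add: ln_mult ln_realpow)
    also have "real T * ln R \<le> (real M + 1 + 6 * real y powr a) * (ln 3 + real \<kappa> * ln (real y))"
    proof (rule mult_mono)
      have "ln R \<le> ln (3 * real y ^ \<kappa>)" using R y elim(2) by (subst ln_le_cancel_iff) auto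
      also have "\<dots> = ln 3 + real \<kappa> * ln (real y)" using elim(2) by (simp add: ln_mult ln_realpow)
      finally show "ln R \<le> ln 3 + real \<kappa> * ln (real y)" .
    qed (use T u R elim(2) in auto)
    finally have "real (prime_pi y) * ln 2 \<le> ln 2 * real y powr (a + d)"
      using elim(1) by linarith
    then show ?case by (simp add: mult.commute)
  qed
  then show False using prime_pi_not_eventually_small[of "a + d"] a d by simp
qed

end

section \<open>The four statistics\<close>

text \<open>
  Infinitely many primes have valuation \<open>0\<close> at \<open>n\<close>. With \<open>0 \<in> J\<close> the right-hand side would be the
  cardinality of an infinite set, that is \<open>0\<close>, whatever the other exponents in \<open>J\<close>.
\<close>
lemma prime_count_eq_omega_sum:
  assumes "n \<ge> 1" "0 \<notin> J"
  shows "omega_sum J n = prime_count J n"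
proof -
  let ?I = "{j. j \<in> J \<and> omega j n \<noteq> 0}"
  let ?Q = "\<lambda>j. {p. prime p \<and> multiplicity p n = j}"
  have fin: "finite (?Q j)" if "j \<in> J" for j
  proof (rule finite_subset)
    have "j \<noteq> 0" using that assms(2) by (cases "j = 0") auto
    then have "p dvd n" if "multiplicity p n = j" for p
      using that not_dvd_imp_multiplicity_0[of p n] by auto
    then show "?Q j \<subseteq> {p. p dvd n}" by blast
  qed (use assms in \<open>simp add: finite_divisors_nat\<close>)
  have "omega_sum J n = (\<Sum>j\<in>?I. card (?Q j))" by (simp add: omega_sum_def omega_def)
  also have "\<dots> = card (\<Union>j\<in>?I. ?Q j)"
    using finite_omega_support[of n J] assms(1) fin by (intro card_UN_disjoint[symmetric]) auto
  also have "(\<Union>j\<in>?I. ?Q j) = {p. prime p \<and> multiplicity p n \<in> J}"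
  proof -
    have "omega (multiplicity p n) n \<noteq> 0" if "prime p" "multiplicity p n \<in> J" for p
      using fin[OF that(2)] that by (auto simp: omega_def)
    then show ?thesis by auto
  qed
  finally show ?thesis by (simp add: prime_count_def)
qed

lemma exponent_set_ge_2:
  assumes "\<kappa> \<in> J" "\<And>j. j \<in> J \<Longrightarrow> \<kappa> \<le> j" "\<kappa> \<ge> 2"
  shows "exponent_set J \<kappa>"
proof
  show "summable (prime_power_weight \<kappa>)"
  proof (rule summable_comparison_test')
    show "summable (\<lambda>n. inverse (real n ^ \<kappa>))" using inverse_power_summable[OF assms(3)] by simp
    show "norm (prime_power_weight \<kappa> p) \<le> inverse (real p ^ \<kappa>)" for p
      by (simp add: prime_power_weight_def divide_inverse)
  qed
qed (use assms in auto)

lemma (in exponent_set) generating_function_entire: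
  assumes "\<And>p z. prime p \<Longrightarrow> f z p = 1 + of_real (mult_density J p) * (z - 1)"
  shows "\<exists>F::complex \<Rightarrow> complex. F holomorphic_on UNIV \<and>
    (\<forall>z. (\<lambda>m. of_real (E m) * z ^ m) sums F z \<and> has_prime_prod (f z) (F z))"
proof (intro exI conjI allI)
  fix z :: complex
  have "(\<lambda>p. if prime p then f z p else 1) = (\<lambda>p. if prime p then 1 + of_real (c p) * (z - 1) else 1)"
    using assms by (auto simp: prime_density_def)
  with has_prime_prod_generating_function[of z]
  show "has_prime_prod (f z) (\<Sum>m. of_real (E m) * z ^ m)"
    unfolding has_prime_prod_def by simp
qed (rule entire generating_function(1))+

lemma mult_density_singleton: "mult_density {k} p = (1 - 1 / real p) * (1 / real p) ^ k"
proof -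
  have "(\<lambda>j. if j \<in> {k} then (1 - 1 / real p) * (1 / real p) ^ j else 0) sums ((1 - 1 / real p) * (1 / real p) ^ k)"
    using sums_single[of k "\<lambda>j. (1 - 1 / real p) * (1 / real p) ^ j"] by simp
  then show ?thesis by (simp add: mult_density_def sums_iff)
qed

text \<open>
  All infinite sets of exponents that occur are arithmetic progressions, for which the density is a
  geometric series.
\<close>
lemma mult_density_progression:
  assumes "prime p" "b \<ge> 1"
  shows "mult_density (range (\<lambda>i. a + b * i)) p
    = (1 - 1 / real p) * (1 / real p) ^ a / (1 - (1 / real p) ^ b)"
proof -
  define r where "r = 1 / real p"
  have r: "0 < r" "r < 1" using prime_gt_1_nat[OF assms(1)] by (auto simp: r_def)
  have "r ^ b < 1" using r assms(2) by (simp add: power_less_one_iff)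
  have "(\<lambda>i. (1 - r) * r ^ a * (r ^ b) ^ i) sums ((1 - r) * r ^ a * (1 / (1 - r ^ b)))"
    using r \<open>r ^ b < 1\<close> by (intro sums_mult geometric_sums) auto
  moreover have "a + b * i \<in> range (\<lambda>i. a + b * i)" for i by blast
  ultimately have "(\<lambda>i. if a + b * i \<in> range (\<lambda>i. a + b * i) then (1 - r) * r ^ (a + b * i) else 0)
      sums ((1 - r) * r ^ a / (1 - r ^ b))"
    by (simp only: if_True power_add power_mult mult.assoc times_divide_eq_right mult_1_right)
  moreover have "strict_mono (\<lambda>i. a + b * i)" using assms(2) by (intro strict_monoI) auto
  ultimately have "(\<lambda>j. if j \<in> range (\<lambda>i. a + b * i) then (1 - r) * r ^ j else 0)
      sums ((1 - r) * r ^ a / (1 - r ^ b))"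
    by (subst (asm) sums_mono_reindex[where f = "\<lambda>j. if j \<in> range (\<lambda>i. a + b * i) then (1 - r) * r ^ j else 0"]) auto
  then show ?thesis unfolding mult_density_def r_def[symmetric] by (rule sums_unique[symmetric])
qed

lemma range_S: "{j::nat. j \<ge> 2} = range (\<lambda>i. 2 + 1 * i)"
  by (auto simp: le_iff_add)

lemma range_E: "{j::nat. j \<ge> 2 \<and> even j} = range (\<lambda>i. 2 + 2 * i)"
proof (intro equalityI subsetI)
  fix j :: nat assume "j \<in> {j. j \<ge> 2 \<and> even j}"
  then have "j = 2 + 2 * (j div 2 - 1)" by auto
  then show "j \<in> range (\<lambda>i. 2 + 2 * i)" by blast
qed auto

lemma range_O: "{j::nat. j \<ge> 3 \<and> odd j} = range (\<lambda>i. 3 + 2 * i)"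
proof (intro equalityI subsetI)
  fix j :: nat assume "j \<in> {j. j \<ge> 3 \<and> odd j}"
  then have "j = 3 + 2 * (j div 2 - 1)" by (auto elim!: oddE)
  then show "j \<in> range (\<lambda>i. 3 + 2 * i)" by blast
qed auto

lemma local_factors:
  assumes "prime p"
  shows "complex_of_real (mult_density {k} p) * (z - 1) = (of_nat p - 1) * (z - 1) / of_nat p ^ (k + 1)"
    and "complex_of_real (mult_density {j. j \<ge> 2} p) * (z - 1) = (z - 1) / of_nat p ^ 2"
    and "complex_of_real (mult_density {j. j \<ge> 2 \<and> even j} p) * (z - 1) = (z - 1) / (of_nat p * (of_nat p + 1))"
    and "complex_of_real (mult_density {j. j \<ge> 3 \<and> odd j} p) * (z - 1) = (z - 1) / (of_nat p ^ 2 * (of_nat p + 1))"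
proof -
  have p: "real p > 1" using prime_gt_1_nat[OF assms] by simp
  have "mult_density {k} p = (real p - 1) / real p ^ (k + 1)"
    using p by (simp add: mult_density_singleton power_divide field_simps)
  then show "complex_of_real (mult_density {k} p) * (z - 1) = (of_nat p - 1) * (z - 1) / of_nat p ^ (k + 1)"
    by simp
  have nz: "1 - 1 / real p \<noteq> 0" using p by simp
  have "mult_density {j. j \<ge> 2} p = 1 / real p ^ 2"
    unfolding range_S mult_density_progression[OF assms order_refl] using nz
    by (simp add: power_divide)
  then show "complex_of_real (mult_density {j. j \<ge> 2} p) * (z - 1) = (z - 1) / of_nat p ^ 2"
    by simp
  have sq: "1 - (1 / real p)\<^sup>2 = (1 - 1 / real p) * ((real p + 1) / real p)"
    using p by (simp add: field_simps power2_eq_square)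
  have "mult_density {j. j \<ge> 2 \<and> even j} p = 1 / (real p * (real p + 1))"
    unfolding range_E mult_density_progression[OF assms one_le_numeral] sq
      mult_divide_mult_cancel_left[OF nz]
    by (simp add: power2_eq_square)
  then show "complex_of_real (mult_density {j. j \<ge> 2 \<and> even j} p) * (z - 1) = (z - 1) / (of_nat p * (of_nat p + 1))"
    by simp
  have "mult_density {j. j \<ge> 3 \<and> odd j} p = 1 / (real p ^ 2 * (real p + 1))"
    unfolding range_O mult_density_progression[OF assms one_le_numeral] sq
      mult_divide_mult_cancel_left[OF nz]
    by (simp add: power2_eq_square power3_eq_cube)
  then show "complex_of_real (mult_density {j. j \<ge> 3 \<and> odd j} p) * (z - 1) = (z - 1) / (of_nat p ^ 2 * (of_nat p + 1))"
    by simp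
qed

theorem mainTheorem4:
  shows
    "(\<forall>k::nat. k \<ge> 2 \<longrightarrow>
        (\<forall>m. has_natural_density {n. n \<ge> 1 \<and> omega k n = m} (e k m)) \<and>
        (\<exists>\<delta>::nat \<Rightarrow> real. \<delta> \<longlonglongrightarrow> 0 \<and>
           (\<forall>\<^sub>F m in sequentially. e k m \<le> real m powr (- (real k - \<delta> m) * real m))) \<and>
        (\<forall>\<epsilon>::real. \<epsilon> > 0 \<longrightarrow>
           infinite {m::nat. e k m \<ge> real m powr (- (real k + \<epsilon>) * real m)}) \<and>
        (\<exists>F::complex \<Rightarrow> complex. F holomorphic_on UNIV \<and>
           (\<forall>z. (\<lambda>m. of_real (e k m) * z ^ m) sums F z \<and>
                has_prime_prod
                  (\<lambda>p. 1 + (of_nat p - 1) * (z - 1) / of_nat p ^ (k + 1)) (F z))))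
     \<and>
     ((\<forall>m. has_natural_density {n. n \<ge> 1 \<and> omega_S n = m} (e_S m)) \<and>
      (\<forall>m. has_natural_density {n. n \<ge> 1 \<and> omega_E n = m} (e_E m)) \<and>
      (\<forall>m. has_natural_density {n. n \<ge> 1 \<and> omega_O n = m} (e_O m)) \<and>
      (\<forall>\<epsilon>::real. \<epsilon> > 0 \<longrightarrow>
         infinite {m::nat. e_S m \<ge> real m powr (- (2 + \<epsilon>) * real m)} \<and>
         infinite {m::nat. e_E m \<ge> real m powr (- (2 + \<epsilon>) * real m)} \<and>
         infinite {m::nat. e_O m \<ge> real m powr (- (3 + \<epsilon>) * real m)}) \<and>
      (\<exists>F::complex \<Rightarrow> complex. F holomorphic_on UNIV \<and>
         (\<forall>z. (\<lambda>m. of_real (e_S m) * z ^ m) sums F z \<and>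
              has_prime_prod (\<lambda>p. 1 + (z - 1) / of_nat p ^ 2) (F z))) \<and>
      (\<exists>F::complex \<Rightarrow> complex. F holomorphic_on UNIV \<and>
         (\<forall>z. (\<lambda>m. of_real (e_E m) * z ^ m) sums F z \<and>
              has_prime_prod (\<lambda>p. 1 + (z - 1) / (of_nat p * (of_nat p + 1))) (F z))) \<and>
      (\<exists>F::complex \<Rightarrow> complex. F holomorphic_on UNIV \<and>
         (\<forall>z. (\<lambda>m. of_real (e_O m) * z ^ m) sums F z \<and>
              has_prime_prod (\<lambda>p. 1 + (z - 1) / (of_nat p ^ 2 * (of_nat p + 1))) (F z))))"
proof (intro conjI allI impI)
  fix k :: nat assume k: "k \<ge> 2"
  then interpret exponent_set "{k}" k by (intro exponent_set_ge_2) auto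
  have set: "{n. n \<ge> 1 \<and> omega k n = m} = {n. n \<ge> 1 \<and> prime_count {k} n = m}" for m
    by (simp add: omega_def prime_count_def)
  have e: "e k = E" by (rule ext) (simp only: e_def E_def set)
  show "has_natural_density {n. n \<ge> 1 \<and> omega k n = m} (e k m)" for m
    unfolding set e by (rule has_density)
  show "\<exists>\<delta>::nat \<Rightarrow> real. \<delta> \<longlonglongrightarrow> 0 \<and>
      (\<forall>\<^sub>F m in sequentially. e k m \<le> real m powr (- (real k - \<delta> m) * real m))"
    unfolding e by (rule E_upper_bound[OF k])
  show "infinite {m::nat. e k m \<ge> real m powr (- (real k + \<epsilon>) * real m)}" if "\<epsilon> > 0" for \<epsilon> :: real
    unfolding e by (rule E_lower_bound[OF that])
  show "\<exists>F::complex \<Rightarrow> complex. F holomorphic_on UNIV \<and>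
           (\<forall>z. (\<lambda>m. of_real (e k m) * z ^ m) sums F z \<and>
                has_prime_prod (\<lambda>p. 1 + (of_nat p - 1) * (z - 1) / of_nat p ^ (k + 1)) (F z))"
    unfolding e by (rule generating_function_entire) (simp only: local_factors)
next
  interpret exponent_set "{j. j \<ge> 2}" 2 by (intro exponent_set_ge_2) auto
  have "{n. n \<ge> 1 \<and> omega_S n = m} = {n. n \<ge> 1 \<and> prime_count {j. j \<ge> 2} n = m}" for m
    by (auto simp: omega_S_def prime_count_eq_omega_sum)
  note set = this
  have e: "e_S = E" by (rule ext) (simp only: e_S_def E_def set)
  show "has_natural_density {n. n \<ge> 1 \<and> omega_S n = m} (e_S m)" for m
    unfolding set e by (rule has_density)
  show "infinite {m::nat. e_S m \<ge> real m powr (- (2 + \<epsilon>) * real m)}" if "\<epsilon> > 0" for \<epsilon> :: real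
    using E_lower_bound[OF that] by (simp add: e)
  show "\<exists>F::complex \<Rightarrow> complex. F holomorphic_on UNIV \<and>
         (\<forall>z. (\<lambda>m. of_real (e_S m) * z ^ m) sums F z \<and>
              has_prime_prod (\<lambda>p. 1 + (z - 1) / of_nat p ^ 2) (F z))"
    unfolding e by (rule generating_function_entire) (simp only: local_factors)
next
  interpret exponent_set "{j. j \<ge> 2 \<and> even j}" 2 by (intro exponent_set_ge_2) auto
  have "{n. n \<ge> 1 \<and> omega_E n = m} = {n. n \<ge> 1 \<and> prime_count {j. j \<ge> 2 \<and> even j} n = m}" for m
    by (auto simp: omega_E_def prime_count_eq_omega_sum)
  note set = this
  have e: "e_E = E" by (rule ext) (simp only: e_E_def E_def set)
  show "has_natural_density {n. n \<ge> 1 \<and> omega_E n = m} (e_E m)" for m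
    unfolding set e by (rule has_density)
  show "infinite {m::nat. e_E m \<ge> real m powr (- (2 + \<epsilon>) * real m)}" if "\<epsilon> > 0" for \<epsilon> :: real
    using E_lower_bound[OF that] by (simp add: e)
  show "\<exists>F::complex \<Rightarrow> complex. F holomorphic_on UNIV \<and>
         (\<forall>z. (\<lambda>m. of_real (e_E m) * z ^ m) sums F z \<and>
              has_prime_prod (\<lambda>p. 1 + (z - 1) / (of_nat p * (of_nat p + 1))) (F z))"
    unfolding e by (rule generating_function_entire) (simp only: local_factors)
next
  interpret exponent_set "{j. j \<ge> 3 \<and> odd j}" 3 by (intro exponent_set_ge_2) auto
  have "{n. n \<ge> 1 \<and> omega_O n = m} = {n. n \<ge> 1 \<and> prime_count {j. j \<ge> 3 \<and> odd j} n = m}" for m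
    by (auto simp: omega_O_def prime_count_eq_omega_sum)
  note set = this
  have e: "e_O = E" by (rule ext) (simp only: e_O_def E_def set)
  show "has_natural_density {n. n \<ge> 1 \<and> omega_O n = m} (e_O m)" for m
    unfolding set e by (rule has_density)
  show "infinite {m::nat. e_O m \<ge> real m powr (- (3 + \<epsilon>) * real m)}" if "\<epsilon> > 0" for \<epsilon> :: real
    using E_lower_bound[OF that] by (simp add: e)
  show "\<exists>F::complex \<Rightarrow> complex. F holomorphic_on UNIV \<and>
         (\<forall>z. (\<lambda>m. of_real (e_O m) * z ^ m) sums F z \<and>
              has_prime_prod (\<lambda>p. 1 + (z - 1) / (of_nat p ^ 2 * (of_nat p + 1))) (F z))"
    unfolding e by (rule generating_function_entire) (simp only: local_factors)
qed

end
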